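(* For any nonlocal game $\mathcal G(\pi,V)$: (i) the classical value satisfies $\omega_{\mathcal C}(\mathcal G)=\omega(\mathcal{CP},\mathcal G)$; (ii) the quantum value satisfies $\omega_{\mathcal Q}(\mathcal G)=\omega(\mathcal{CS}_+,\mathcal G)$; (iii) the no-signaling value satisfies $\omega_{\mathcal{NS}}(\mathcal G)=\omega(\mathcal{NSO},\mathcal G)$; (iv) the unrestricted value satisfies $\omega_{\mathcal P}(\mathcal G)=\omega(\mathcal N,\mathcal G)$.
   Context: A nonlocal game $\mathcal G(\pi,V)$ consists of finite nonempty sets $S,T$ (questions), $A,B$ (answers), a probability distribution $\pi$ on $S\times T$ and a predicate $V:A\times B\times S\times T\to\{0,1\}$, written $V(a,b|s,t)$. Correlation sets. $\mathcal{P}$: vectors $p=(p(a,b|s,t))$ with $p(a,b|s,t)\ge 0$ and $\sum_{a,b}p(a,b|s,t)=1$ for all $s,t$. $\mathcal{C}$: $p\in\mathcal P$ such that for some $n$ there are nonnegative reals $k_i,x_a^{s,i},y_b^{t,i}$ ($i\in[n]$) with $\sum_i k_i=1$, $\sum_a x_a^{s,i}=\sum_b y_b^{t,i}=1$ for all $s,t,i$, and $p(a,b|s,t)=\sum_{i=1}^n k_i x_a^{s,i}y_b^{t,i}$. $\mathcal{Q}$: $p\in\mathcal P$ such that there are finite-dimensional complex Euclidean spaces $\mathcal X,\mathcal Y$, a unit vector $\psi\in\mathcal X\otimes\mathcal Y$, Hermitian psd operators $X_a^s$ on $\mathcal X$ with $\sum_a X_a^s=\mathbb I_{\mathcal X}$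 for each $s$, and Hermitian psd $Y_b^t$ on $\mathcal Y$ with $\sum_b Y_b^t=\mathbb I_{\mathcal Y}$ for each $t$, with $p(a,b|s,t)=\psi^*(X_a^s\otimes Y_b^t)\psi$. $\mathcal{NS}$: $p\in\mathcal P$ with $\sum_b p(a,b|s,t)=\sum_b p(a,b|s,t')$ for all $a,s,t\neq t'$, and $\sum_a p(a,b|s,t)=\sum_a p(a,b|s',t)$ for all $b,t,s\ne s'$. For $\mathcal R\subseteq\mathcal P$, $\omega_{\mathcal R}(\mathcal G):=\sup\{\sum_{s,t}\pi(s,t)\sum_{a,b}V(a,b|s,t)p(a,b|s,t):p\in\mathcal R\}$. Let $N=|S||A|+|T||B|$; real symmetric $N\times N$ matrices are indexed by the disjoint union of $S\times A$ and $T\times B$ (in $S\cup T$, $S$ and $T$ are regarded as disjoint). $\langle J_{i,j},X\rangle:=\sum_{k,l}X[(i,k),(j,l)]$ is the sum of entries in block $(i,j)$, $i,j\in S\cup T$. Let $C[(s,a),(t,b)]=\pi(s,t)V(a,b|s,t)$ and $\hat C=\frac12\begin{pmatrix}0&C\\C^{\mathsf T}&0\end{pmatrix}$. For a convex cone $\mathcal K$ of entrywise nonnegative symmetric $N\times N$ matrices, $$\omega(\mathcal K,\mathcal G):=\sup\{\mathrm{Tr}(\hat CX):\langle J_{i,j},X\rangle=1\ \forall i,j\in S\cup T,\ X\in\mathcal K\}.$$ Cones (all of size $N$). $\mathcal N$: entrywise nonnegative symmetric matrices. $\mathcal{CP}$: Gram matrices $(\langle x_i,x_j\rangle)$ of vectors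 $x_i\in\mathbb R^d_+$ (some $d\ge1$). $\mathcal{CS}_+$: matrices $(\mathrm{Tr}(X_iX_j))$ with $X_i$ real symmetric psd $d\times d$ (some $d\ge1$). $\mathcal{NSO}$: $X\in\mathcal N$ with $\sum_{a}X[(s,a),(t,b)]=\sum_{a}X[(s',a),(t,b)]$ for all $b,t,s\neq s'$, and $\sum_{b}X[(s,a),(t,b)]=\sum_{b}X[(s,a),(t',b)]$ for all $a,s,t\ne t'$. *)

theory Defs
  imports
    "HOL-Probability.Probability"
    "Jordan_Normal_Form.Schur_Decomposition"
begin

(* Two kinds of matrices occur. The N x N matrices indexed by (S x A) + (T x B) have a fixed
   finite index type and are elements of real^_^_ (HOL-Analysis). Operators and vectors whose
   dimension is existentially quantified live in Jordan_Normal_Form (types _ mat and _ vec).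
   The infix $ below is always the HOL-Analysis one. *)
no_notation Matrix.vec_index (infixl \<open>$\<close> 100)
no_notation inner (infix \<open>\<bullet>\<close> 70)

section \<open>Games and correlations\<close>

(* The finite nonempty sets A, B, S, T are finite types; p a b s t stands for p(a,b|s,t), and
   V a b s t for V(a,b|s,t) = 1. *)
type_synonym ('a, 'b, 's, 't) correlation = "'a \<Rightarrow> 'b \<Rightarrow> 's \<Rightarrow> 't \<Rightarrow> real"
type_synonym ('a, 'b, 's, 't) predicate = "'a \<Rightarrow> 'b \<Rightarrow> 's \<Rightarrow> 't \<Rightarrow> bool"

definition corr_P :: "('a::finite, 'b::finite, 's::finite, 't::finite) correlation set" where
  "corr_P = {p. (\<forall>a b s t. 0 \<le> p a b s t) \<and>
                (\<forall>s t. (\<Sum>a\<in>UNIV. \<Sum>b\<in>UNIV. p a b s t) = 1)}"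

definition corr_C :: "('a::finite, 'b::finite, 's::finite, 't::finite) correlation set" where
  "corr_C = {p \<in> corr_P.
     \<exists>(n::nat) (k :: nat \<Rightarrow> real) (x :: 's \<Rightarrow> 'a \<Rightarrow> nat \<Rightarrow> real) (y :: 't \<Rightarrow> 'b \<Rightarrow> nat \<Rightarrow> real).
       (\<forall>i<n. 0 \<le> k i \<and> (\<forall>s a. 0 \<le> x s a i) \<and> (\<forall>t b. 0 \<le> y t b i)) \<and>
       (\<Sum>i<n. k i) = 1 \<and>
       (\<forall>i<n. (\<forall>s. (\<Sum>a\<in>UNIV. x s a i) = 1) \<and> (\<forall>t. (\<Sum>b\<in>UNIV. y t b i) = 1)) \<and>
       (\<forall>a b s t. p a b s t = (\<Sum>i<n. k i * x s a i * y t b i))}"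

(* For complex matrices the order is the partial order of HOL-Library.Complex_Order, so the
   last conjunct says that the quadratic form v* A v is real and nonnegative. For real
   matrices conjugation is the identity, so these are the real symmetric psd matrices. *)
definition psd_mat :: "nat \<Rightarrow> 'k::conjugatable_ordered_field mat \<Rightarrow> bool" where
  "psd_mat d A \<longleftrightarrow> A \<in> carrier_mat d d \<and> mat_adjoint A = A \<and>
     (\<forall>v\<in>carrier_vec d. 0 \<le> (A *\<^sub>v v) \<bullet>c v)"

(* The sum of operators is written entrywise because the type of matrices, whose dimensions
   vary, is not a commutative monoid. *)
definition povm :: "nat \<Rightarrow> ('a::finite \<Rightarrow> complex mat) \<Rightarrow> bool" where
  "povm d M \<longleftrightarrow> (\<forall>a. psd_mat d (M a)) \<and>
     mat d d (\<lambda>(i,j). \<Sum>a\<in>UNIV. M a $$ (i,j)) = 1\<^sub>m d"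

(* Kronecker product: the basis vector e_i (x) e_k of C^m (x) C^n is number i * n + k of C^(m n). *)
definition kron :: "'k::times mat \<Rightarrow> 'k mat \<Rightarrow> 'k mat" where
  "kron A B = mat (dim_row A * dim_row B) (dim_col A * dim_col B)
     (\<lambda>(i,j). A $$ (i div dim_row B, j div dim_col B) * B $$ (i mod dim_row B, j mod dim_col B))"

definition corr_Q :: "('a::finite, 'b::finite, 's::finite, 't::finite) correlation set" where
  "corr_Q = {p \<in> corr_P.
     \<exists>m n \<psi> (X :: 's \<Rightarrow> 'a \<Rightarrow> complex mat) (Y :: 't \<Rightarrow> 'b \<Rightarrow> complex mat).
       \<psi> \<in> carrier_vec (m * n) \<and> \<psi> \<bullet>c \<psi> = 1 \<and>
       (\<forall>s. povm m (X s)) \<and> (\<forall>t. povm n (Y t)) \<and>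
       (\<forall>a b s t. complex_of_real (p a b s t) = (kron (X s a) (Y t b) *\<^sub>v \<psi>) \<bullet>c \<psi>)}"

definition corr_NS :: "('a::finite, 'b::finite, 's::finite, 't::finite) correlation set" where
  "corr_NS = {p \<in> corr_P.
     (\<forall>a s t t'. t \<noteq> t' \<longrightarrow> (\<Sum>b\<in>UNIV. p a b s t) = (\<Sum>b\<in>UNIV. p a b s t')) \<and>
     (\<forall>b t s s'. s \<noteq> s' \<longrightarrow> (\<Sum>a\<in>UNIV. p a b s t) = (\<Sum>a\<in>UNIV. p a b s' t))}"

(* Suprema of values are taken in the extended reals, where they need no side conditions. *)
definition game_value ::
  "('a::finite, 'b::finite, 's::finite, 't::finite) correlation set
    \<Rightarrow> ('s \<times> 't) pmf \<Rightarrow> ('a, 'b, 's, 't) predicate \<Rightarrow> ereal" where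
  "game_value R \<pi> V = (SUP p\<in>R. ereal
     (\<Sum>s\<in>UNIV. \<Sum>t\<in>UNIV. pmf \<pi> (s,t) *
        (\<Sum>a\<in>UNIV. \<Sum>b\<in>UNIV. of_bool (V a b s t) * p a b s t)))"

section \<open>Conic programs\<close>

type_synonym ('a, 'b, 's, 't) idx = "'s \<times> 'a + 't \<times> 'b"
type_synonym ('a, 'b, 's, 't) sqmat = "real^('a, 'b, 's, 't) idx^('a, 'b, 's, 't) idx"

fun block :: "'s + 't \<Rightarrow> ('a::finite, 'b::finite, 's::finite, 't::finite) idx set" where
  "block (Inl s) = (\<lambda>a. Inl (s,a)) ` UNIV"
| "block (Inr t) = (\<lambda>b. Inr (t,b)) ` UNIV"

definition block_sum ::
  "'s + 't \<Rightarrow> 's + 't \<Rightarrow> ('a::finite, 'b::finite, 's::finite, 't::finite) sqmat \<Rightarrow> real" where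
  "block_sum i j X = (\<Sum>u\<in>block i. \<Sum>v\<in>block j. X $ u $ v)"

definition cost_mat ::
  "('s \<times> 't) pmf \<Rightarrow> ('a::finite, 'b::finite, 's::finite, 't::finite) predicate
    \<Rightarrow> real^('t \<times> 'b)^('s \<times> 'a)" where
  "cost_mat \<pi> V = (\<chi> u v. pmf \<pi> (fst u, fst v) * of_bool (V (snd u) (snd v) (fst u) (fst v)))"

definition sym_cost_mat ::
  "('s \<times> 't) pmf \<Rightarrow> ('a::finite, 'b::finite, 's::finite, 't::finite) predicate
    \<Rightarrow> ('a, 'b, 's, 't) sqmat" where
  "sym_cost_mat \<pi> V = (1/2) *\<^sub>R (\<chi> i j. case (i, j) of
       (Inl u, Inr v) \<Rightarrow> cost_mat \<pi> V $ u $ v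
     | (Inr v, Inl u) \<Rightarrow> transpose (cost_mat \<pi> V) $ v $ u
     | _ \<Rightarrow> 0)"

definition conic_value ::
  "('a::finite, 'b::finite, 's::finite, 't::finite) sqmat set
    \<Rightarrow> ('s \<times> 't) pmf \<Rightarrow> ('a, 'b, 's, 't) predicate \<Rightarrow> ereal" where
  "conic_value K \<pi> V =
     (SUP X\<in>{X\<in>K. \<forall>i j. block_sum i j X = 1}. ereal (trace (sym_cost_mat \<pi> V ** X)))"

section \<open>Cones\<close>

definition cone_N :: "('a::finite, 'b::finite, 's::finite, 't::finite) sqmat set" where
  "cone_N = {X. transpose X = X \<and> (\<forall>u v. 0 \<le> X $ u $ v)}"

definition cone_CP :: "('a::finite, 'b::finite, 's::finite, 't::finite) sqmat set" where
  "cone_CP = {X. \<exists>d\<ge>1. \<exists>x. (\<forall>u. x u \<in> carrier_vec d \<and> 0\<^sub>v d \<le> x u) \<and>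
     X = (\<chi> u v. x u \<bullet> x v)}"

definition cone_CSplus :: "('a::finite, 'b::finite, 's::finite, 't::finite) sqmat set" where
  "cone_CSplus = {X. \<exists>d\<ge>1. \<exists>M :: ('a, 'b, 's, 't) idx \<Rightarrow> real mat. (\<forall>u. psd_mat d (M u)) \<and>
     X = (\<chi> u v. \<Sum>k<d. (M u * M v) $$ (k,k))}"

definition cone_NSO :: "('a::finite, 'b::finite, 's::finite, 't::finite) sqmat set" where
  "cone_NSO = {X \<in> cone_N.
     (\<forall>b t s s'. s \<noteq> s' \<longrightarrow>
        (\<Sum>a\<in>UNIV. X $ Inl (s,a) $ Inr (t,b)) = (\<Sum>a\<in>UNIV. X $ Inl (s',a) $ Inr (t,b))) \<and>
     (\<forall>a s t t'. t \<noteq> t' \<longrightarrow>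
        (\<Sum>b\<in>UNIV. X $ Inl (s,a) $ Inr (t,b)) = (\<Sum>b\<in>UNIV. X $ Inl (s,a) $ Inr (t',b)))}"

end

theory Submission
  imports Defs
begin

text \<open>A feasible \<open>X\<close> carries the correlation in its off-diagonal block; for the cones \<open>N\<close> and \<open>NSO\<close> the
  diagonal blocks are arbitrary. In the Gram cases the constraints say that the vectors of each block add up to one and the same unit vector \<open>\<xi>\<close>.
  Classically, \<open>\<xi>\<^sup>2\<close> is the distribution of the shared randomness and the vectors divided by \<open>\<xi>\<close> are the
  local strategies. In the quantum case \<open>\<xi>\<close> is a psd matrix \<open>K = U diag(lam) U\<^sup>*\<close>: conjugating by
  \<open>U lam\<^sup>-\<^sup>1\<^sup>/\<^sup>2\<close> turns the blocks into POVMs, measured on the state \<open>\<Sum>i. lam i e\<^sub>i \<otimes> e\<^sub>i\<close>. Conversely the spectral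
  decomposition of \<open>P P\<^sup>*\<close>, where \<open>P\<close> is the state as a matrix, turns a quantum strategy into Hermitian
  psd matrices with a common block sum, and \<open>H \<mapsto> (Re H, -Im H; Im H, Re H) / \<surd>2\<close> makes them real.\<close>

section \<open>Positive semidefinite matrices as functions\<close>

lemma sum_rotate3:
  fixes f :: "'a \<Rightarrow> 'b \<Rightarrow> 'c \<Rightarrow> 'd::comm_monoid_add"
  shows "(\<Sum>x\<in>I. \<Sum>u\<in>J. \<Sum>v\<in>K. f x u v) = (\<Sum>u\<in>J. \<Sum>v\<in>K. \<Sum>x\<in>I. f x u v)"
  by (subst sum.swap, intro sum.cong[OF refl], rule sum.swap)

lemma sum_swap_pairs:
  fixes f :: "'a \<Rightarrow> 'b \<Rightarrow> 'c \<Rightarrow> 'd \<Rightarrow> 'e::comm_monoid_add"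
  shows "(\<Sum>i\<in>I. \<Sum>j\<in>J. \<Sum>k\<in>K. \<Sum>l\<in>L. f i j k l) =
    (\<Sum>k\<in>K. \<Sum>l\<in>L. \<Sum>i\<in>I. \<Sum>j\<in>J. f i j k l)"
proof -
  have "(\<Sum>i\<in>I. \<Sum>j\<in>J. \<Sum>k\<in>K. \<Sum>l\<in>L. f i j k l) =
      (\<Sum>i\<in>I. \<Sum>k\<in>K. \<Sum>l\<in>L. \<Sum>j\<in>J. f i j k l)"
    by (intro sum.cong[OF refl] sum_rotate3)
  also have "\<dots> = (\<Sum>k\<in>K. \<Sum>l\<in>L. \<Sum>i\<in>I. \<Sum>j\<in>J. f i j k l)"
    by (rule sum_rotate3)
  finally show ?thesis .
qed

text \<open>Matrices and vectors become plain functions of which only the indices below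
  \<open>d\<close> count, so that entries can be summed freely without carrier conditions.\<close>

definition qform :: "nat \<Rightarrow> (nat \<Rightarrow> nat \<Rightarrow> 'k) \<Rightarrow> (nat \<Rightarrow> 'k::conjugatable_ordered_field) \<Rightarrow> 'k" where
  "qform d A v = (\<Sum>i<d. \<Sum>j<d. conjugate (v i) * A i j * v j)"

definition psd_fun :: "nat \<Rightarrow> (nat \<Rightarrow> nat \<Rightarrow> 'k::conjugatable_ordered_field) \<Rightarrow> bool" where
  "psd_fun d A \<longleftrightarrow> (\<forall>i<d. \<forall>j<d. A i j = conjugate (A j i)) \<and> (\<forall>v. 0 \<le> qform d A v)"

lemma psd_fun_sym: "psd_fun d A \<Longrightarrow> i < d \<Longrightarrow> j < d \<Longrightarrow> conjugate (A i j) = A j i"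
  by (metis conjugate_id psd_fun_def)

lemma psd_fun_qform_nonneg: "psd_fun d A \<Longrightarrow> 0 \<le> qform d A v"
  by (simp add: psd_fun_def)

lemma qform_cong:
  "(\<And>i j. i < d \<Longrightarrow> j < d \<Longrightarrow> A i j = B i j) \<Longrightarrow> (\<And>i. i < d \<Longrightarrow> v i = w i) \<Longrightarrow>
    qform d A v = qform d B w"
  by (simp add: qform_def)

lemma psd_fun_cong:
  "(\<And>i j. i < d \<Longrightarrow> j < d \<Longrightarrow> A i j = B i j) \<Longrightarrow> psd_fun d A \<longleftrightarrow> psd_fun d B"
  by (simp add: psd_fun_def cong: qform_cong)

lemma qform_mat:
  assumes "A \<in> carrier_mat d d" "v \<in> carrier_vec d"
  shows "(A *\<^sub>v v) \<bullet>c v = qform d (\<lambda>i j. A $$ (i,j)) (vec_index v)"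
  using assms
  by (auto simp: qform_def scalar_prod_def sum_distrib_left atLeast0LessThan mult_ac
      intro!: sum.cong)

text \<open>The adjoint is compared entry by entry. The quadratic form sees only the first
  \<open>d\<close> values of \<open>v\<close>, so an arbitrary function may be replaced by
  \<open>vec d v\<close>.\<close>

lemma psd_mat_iff_psd_fun:
  "psd_mat d A \<longleftrightarrow> A \<in> carrier_mat d d \<and> psd_fun d (\<lambda>i j. A $$ (i,j))"
proof -
  have "mat_adjoint A = A \<longleftrightarrow> (\<forall>i<d. \<forall>j<d. A $$ (i,j) = conjugate (A $$ (j,i)))"
    if "A \<in> carrier_mat d d"
  proof -
    have "dim_row (mat_adjoint A) = d" "dim_col (mat_adjoint A) = d"
      and "\<And>i j. i < d \<Longrightarrow> j < d \<Longrightarrow> mat_adjoint A $$ (i,j) = conjugate (A $$ (j,i))"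
      using that by (simp_all add: mat_adjoint_def mat_of_rows_def)
    with that show ?thesis by (metis carrier_matD eq_matI)
  qed
  moreover have "(\<forall>v\<in>carrier_vec d. 0 \<le> (A *\<^sub>v v) \<bullet>c v) \<longleftrightarrow>
      (\<forall>v. 0 \<le> qform d (\<lambda>i j. A $$ (i,j)) v)" if A: "A \<in> carrier_mat d d"
  proof safe
    fix v assume *: "\<forall>v\<in>carrier_vec d. 0 \<le> (A *\<^sub>v v) \<bullet>c v"
    have "qform d (\<lambda>i j. A $$ (i,j)) v = qform d (\<lambda>i j. A $$ (i,j)) (vec_index (vec d v))"
      by (rule qform_cong) auto
    then show "0 \<le> qform d (\<lambda>i j. A $$ (i,j)) v"
      using bspec[OF *, of "vec d v"] qform_mat[OF A, of "vec d v"] by simp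
  qed (simp add: qform_mat[OF A])
  ultimately show ?thesis unfolding psd_mat_def psd_fun_def by blast
qed

definition congr :: "nat \<Rightarrow> (nat \<Rightarrow> nat \<Rightarrow> complex) \<Rightarrow> (nat \<Rightarrow> nat \<Rightarrow> complex) \<Rightarrow> nat \<Rightarrow> nat \<Rightarrow> complex" where
  "congr d C A i j = (\<Sum>k<d. \<Sum>l<d. cnj (C k i) * A k l * C l j)"

text \<open>\<open>congr d C A\<close> is \<open>C\<^sup>* A C\<close>, whose form at
  \<open>v\<close> is the form of \<open>A\<close> at \<open>C v\<close>. As \<open>C\<close> may be
  rectangular, the new size \<open>e\<close> is independent of \<open>d\<close>.\<close>

lemma psd_fun_congr:
  assumes A: "psd_fun d A"
  shows "psd_fun e (congr d C A)"
  unfolding psd_fun_def congr_def[abs_def]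
proof (intro conjI allI impI)
  let ?B = "\<lambda>i j. \<Sum>k<d. \<Sum>l<d. cnj (C k i) * A k l * C l j"
  fix i j
  have "conjugate (?B j i) = (\<Sum>k<d. \<Sum>l<d. C k j * A l k * cnj (C l i))"
    using psd_fun_sym[OF A] by simp
  also have "\<dots> = ?B i j"
    by (subst sum.swap) (simp add: mult_ac)
  finally show "?B i j = conjugate (?B j i)" ..
next
  let ?B = "\<lambda>i j. \<Sum>k<d. \<Sum>l<d. cnj (C k i) * A k l * C l j"
  fix v
  have "qform e ?B v =
      (\<Sum>i<e. \<Sum>j<e. \<Sum>k<d. \<Sum>l<d. cnj (v i) * cnj (C k i) * A k l * C l j * v j)"
    by (simp add: qform_def sum_distrib_left sum_distrib_right mult_ac)
  also have "\<dots> = (\<Sum>k<d. \<Sum>l<d. \<Sum>i<e. \<Sum>j<e. cnj (v i) * cnj (C k i) * A k l * C l j * v j)"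
    by (rule sum_swap_pairs)
  also have "\<dots> = qform d A (\<lambda>k. \<Sum>i<e. C k i * v i)"
    by (simp add: qform_def sum_distrib_left sum_distrib_right mult_ac)
  finally show "0 \<le> qform e ?B v" using psd_fun_qform_nonneg[OF A] by simp
qed

text \<open>If the form vanishes at \<open>v\<close>, then its value at \<open>v + t A v\<close> is \<open>2 t |A v|\<^sup>2 + O(t\<^sup>2)\<close>,
  which is negative for a small negative \<open>t\<close> unless \<open>A v = 0\<close>.\<close>

lemma psd_fun_null:
  fixes A :: "nat \<Rightarrow> nat \<Rightarrow> complex"
  assumes A: "psd_fun d A" and v: "qform d A v = 0" and "i < d"
  shows "(\<Sum>j<d. A i j * v j) = 0"
proof -
  define w where "w i = (\<Sum>j<d. A i j * v j)" for i
  define N where "N = (\<Sum>i<d. (cmod (w i))\<^sup>2)"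
  define Q where "Q = Re (qform d A w)"
  have Q: "qform d A w = complex_of_real Q"
    using psd_fun_qform_nonneg[OF A, of w] by (simp add: Q_def less_eq_complex_def complex_eq_iff)
  have N1: "(\<Sum>i<d. \<Sum>j<d. cnj (w i) * A i j * v j) = complex_of_real N"
  proof -
    have "(\<Sum>i<d. \<Sum>j<d. cnj (w i) * A i j * v j) = (\<Sum>i<d. cnj (w i) * w i)"
      by (simp add: w_def sum_distrib_left mult.assoc)
    also have "\<dots> = complex_of_real N"
      by (simp add: N_def complex_norm_square mult.commute del: of_real_power)
    finally show ?thesis .
  qed
  have "(\<Sum>i<d. \<Sum>j<d. cnj (v i) * A i j * w j) = (\<Sum>j<d. \<Sum>i<d. cnj (v i) * A i j * w j)"
    by (rule sum.swap)
  also have "\<dots> = (\<Sum>j<d. \<Sum>i<d. cnj (cnj (w j) * A j i * v i))"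
    using psd_fun_sym[OF A] by (intro sum.cong refl) (simp add: mult_ac)
  also have "\<dots> = cnj (complex_of_real N)"
    unfolding N1[symmetric] by simp
  finally have N2: "(\<Sum>i<d. \<Sum>j<d. cnj (v i) * A i j * w j) = complex_of_real N" by simp
  have quad: "0 \<le> 2 * t * N + t\<^sup>2 * Q" for t :: real
  proof -
    have "qform d A (\<lambda>i. v i + of_real t * w i) =
        qform d A v + of_real t * (\<Sum>i<d. \<Sum>j<d. cnj (w i) * A i j * v j)
        + of_real t * (\<Sum>i<d. \<Sum>j<d. cnj (v i) * A i j * w j) + of_real t * of_real t * qform d A w"
      by (simp add: qform_def algebra_simps sum.distrib sum_distrib_left)
    also have "\<dots> = complex_of_real (2 * t * N + t\<^sup>2 * Q)"
      unfolding v N1 N2 Q by (simp add: power2_eq_square)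
    finally show ?thesis
      using psd_fun_qform_nonneg[OF A, of "\<lambda>i. v i + of_real t * w i"]
      by (simp add: less_eq_complex_def)
  qed
  have "0 \<le> N" by (simp add: N_def sum_nonneg)
  moreover have "0 \<le> Q" using psd_fun_qform_nonneg[OF A, of w] by (simp add: Q_def less_eq_complex_def)
  ultimately have "N = 0"
  proof (cases "N = 0")
    case False
    with \<open>0 \<le> N\<close> have "0 < N" by simp
    \<comment> \<open>This \<open>t\<close> solves \<open>t * Q = - N - t\<close>, so the quadratic
      factors as \<open>t * (N - t)\<close>; the \<open>+ 1\<close> keeps the denominator positive
      when \<open>Q = 0\<close>.\<close>
    define t where "t = - N / (Q + 1)"
    have "t < 0" using \<open>0 < N\<close> \<open>0 \<le> Q\<close> by (simp add: t_def)
    have "t * Q = - N - t" using \<open>0 \<le> Q\<close> by (simp add: t_def field_simps)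
    then have "2 * t * N + t\<^sup>2 * Q = t * (N - t)"
      by (simp add: power2_eq_square mult.assoc) (simp add: algebra_simps)
    also have "\<dots> < 0"
      using \<open>t < 0\<close> \<open>0 < N\<close> by (intro mult_neg_pos) auto
    finally show ?thesis using quad[of t] by simp
  qed
  then show ?thesis
    using \<open>i < d\<close> by (simp add: N_def sum_nonneg_eq_0_iff w_def)
qed

text \<open>The trace is invariant under the similarity to Schur's triangular form, hence equal to
  the sum of the eigenvalues; if it is nonzero, so is one of them. Its eigenvector is then
  normalized.\<close>

lemma exists_nonzero_eigenvector:
  fixes A :: "nat \<Rightarrow> nat \<Rightarrow> complex"
  assumes "(\<Sum>i<d. A i i) \<noteq> 0"
  obtains \<mu> v where "\<mu> \<noteq> 0" "(\<Sum>i<d. (cmod (v i))\<^sup>2) = 1" "\<And>i. i < d \<Longrightarrow> (\<Sum>j<d. A i j * v j) = \<mu> * v i"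
proof -
  define M where "M = mat d d (\<lambda>(i,j). A i j)"
  have M: "M \<in> carrier_mat d d" by (simp add: M_def)
  obtain es where es: "char_poly M = (\<Prod>a\<leftarrow>es. [:- a, 1:])" "length es = d"
    using char_poly_factorized[OF M] by blast
  obtain T P Q where T: "schur_decomposition M es = (T, P, Q)"
    by (cases "schur_decomposition M es") auto
  have wit: "similar_mat_wit M T P Q" and diag: "diag_mat T = es"
    using schur_decomposition[OF M es(1) T] by auto
  note sim = similar_mat_witD2[OF M wit]
  have trace_comm: "(\<Sum>i<d. (B * C) $$ (i,i)) = (\<Sum>i<d. (C * B) $$ (i,i))"
    if "B \<in> carrier_mat d d" "C \<in> carrier_mat d d" for B C :: "complex mat"
  proof -
    have "(\<Sum>i<d. (B * C) $$ (i,i)) = (\<Sum>i<d. \<Sum>k<d. B $$ (i,k) * C $$ (k,i))"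
      using that by (simp add: scalar_prod_def atLeast0LessThan)
    also have "\<dots> = (\<Sum>k<d. \<Sum>i<d. C $$ (k,i) * B $$ (i,k))"
      by (subst sum.swap) (simp add: mult.commute)
    also have "\<dots> = (\<Sum>i<d. (C * B) $$ (i,i))"
      using that by (simp add: scalar_prod_def atLeast0LessThan)
    finally show ?thesis .
  qed
  have "(\<Sum>i<d. A i i) = (\<Sum>i<d. (P * T * Q) $$ (i,i))"
    unfolding sim(3)[symmetric] by (simp add: M_def)
  also have "\<dots> = (\<Sum>i<d. (Q * (P * T)) $$ (i,i))"
    by (rule trace_comm) (use sim in auto)
  also have "Q * (P * T) = T"
    using sim by (metis assoc_mult_mat left_mult_one_mat)
  also have "(\<Sum>i<d. T $$ (i,i)) = sum_list es"
    using sim(5) diag[symmetric]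
    by (simp add: diag_mat_def sum_list_sum_nth atLeast0LessThan)
  finally have "sum_list es \<noteq> 0" using assms by simp
  then obtain \<mu> where \<mu>: "\<mu> \<in> set es" "\<mu> \<noteq> 0"
    by (metis sum_list_neutral)
  then have "poly (char_poly M) \<mu> = 0"
    by (auto simp: es poly_prod_list prod_list_zero_iff)
  then obtain v where v: "eigenvector M v \<mu>"
    using eigenvalue_root_char_poly[OF M] by (auto simp: eigenvalue_def)
  then have vc: "v \<in> carrier_vec d" and "v \<noteq> 0\<^sub>v d" and Mv: "M *\<^sub>v v = \<mu> \<cdot>\<^sub>v v"
    using M by (auto simp: eigenvector_def)
  define N where "N = (\<Sum>i<d. (cmod (vec_index v i))\<^sup>2)"
  have "\<exists>i<d. vec_index v i \<noteq> 0"
    using vc \<open>v \<noteq> 0\<^sub>v d\<close> by (auto simp: vec_eq_iff)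
  then have N: "N > 0" unfolding N_def by (auto intro!: sum_pos2)
  show ?thesis
  proof (rule that[OF \<mu>(2)])
    show "(\<Sum>i<d. (cmod (vec_index v i / of_real (sqrt N)))\<^sup>2) = 1"
      using N by (simp add: norm_divide power_divide sum_divide_distrib[symmetric] N_def[symmetric])
    show "(\<Sum>j<d. A i j * (vec_index v j / of_real (sqrt N))) = \<mu> * (vec_index v i / of_real (sqrt N))"
      if "i < d" for i
    proof -
      have "vec_index (M *\<^sub>v v) i = vec_index (\<mu> \<cdot>\<^sub>v v) i" by (simp add: Mv)
      then have "(\<Sum>j<d. A i j * vec_index v j) = \<mu> * vec_index v i"
        using that vc by (simp add: M_def scalar_prod_def atLeast0LessThan)
      then show ?thesis by (simp add: sum_divide_distrib[symmetric])
    qed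
  qed
qed

section \<open>The spectral theorem\<close>

definition orthonormal :: "nat \<Rightarrow> nat \<Rightarrow> (nat \<Rightarrow> nat \<Rightarrow> complex) \<Rightarrow> bool" where
  "orthonormal d r U \<longleftrightarrow> (\<forall>k<r. \<forall>l<r. (\<Sum>i<d. cnj (U i k) * U i l) = of_bool (k = l))"

text \<open>The matrix \<open>I - U U\<^sup>*\<close> formed with the first \<open>r\<close> columns
  of \<open>U\<close>: for orthonormal columns, the orthogonal projection onto the complement of
  their span.\<close>

definition compl_proj :: "nat \<Rightarrow> (nat \<Rightarrow> nat \<Rightarrow> complex) \<Rightarrow> nat \<Rightarrow> nat \<Rightarrow> complex" where
  "compl_proj r U i j = of_bool (i = j) - (\<Sum>k<r. U i k * cnj (U j k))"

text \<open>Also used in reverse: where the left side vanishes, \<open>f\<close> is recovered from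
  its products with the columns of \<open>U\<close>.\<close>

lemma sum_mult_compl_proj:
  assumes "j < d"
  shows "(\<Sum>i<d. f i * compl_proj r U i j) = f j - (\<Sum>k<r. (\<Sum>i<d. f i * U i k) * cnj (U j k))"
proof -
  have "(\<Sum>i<d. f i * compl_proj r U i j) =
      (\<Sum>i<d. f i * of_bool (i = j)) - (\<Sum>i<d. \<Sum>k<r. f i * U i k * cnj (U j k))"
    by (simp add: compl_proj_def right_diff_distrib sum_subtractf sum_distrib_left mult.assoc
        del: sum_mult_of_bool_eq)
  also have "(\<Sum>i<d. f i * of_bool (i = j)) = f j"
  proof -
    have "(\<Sum>i<d. f i * of_bool (i = j)) = (\<Sum>i<d. if i = j then f i else 0)"
      by (intro sum.cong) auto
    then show ?thesis using assms by simp
  qed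
  also have "(\<Sum>i<d. \<Sum>k<r. f i * U i k * cnj (U j k)) =
      (\<Sum>k<r. (\<Sum>i<d. f i * U i k) * cnj (U j k))"
    by (subst sum.swap) (simp add: sum_distrib_right)
  finally show ?thesis .
qed

lemma compl_proj_orthogonal:
  assumes U: "orthonormal d r U" and "j < d" "l < r"
  shows "(\<Sum>i<d. cnj (U i l) * compl_proj r U i j) = 0"
proof -
  have "(\<Sum>k<r. (\<Sum>i<d. cnj (U i l) * U i k) * cnj (U j k)) =
      (\<Sum>k<r. if k = l then cnj (U j k) else 0)"
    using U \<open>l < r\<close> by (intro sum.cong) (auto simp: orthonormal_def)
  with \<open>l < r\<close> show ?thesis
    by (simp add: sum_mult_compl_proj[OF \<open>j < d\<close>])
qed

lemma cnj_compl_proj: "cnj (compl_proj r U i j) = compl_proj r U j i"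
  by (auto simp: compl_proj_def mult.commute)

text \<open>The complementary projection is Hermitian and idempotent, so its diagonal entries are
  sums of squared moduli, while its trace is \<open>d - r\<close>.\<close>

lemma orthonormal_le:
  assumes U: "orthonormal d r U"
  shows "r \<le> d"
proof -
  have "0 \<le> Re (compl_proj r U i i)" if "i < d" for i
  proof -
    have "(\<Sum>k<d. compl_proj r U i k * compl_proj r U k i) = compl_proj r U i i -
        (\<Sum>l<r. (\<Sum>k<d. compl_proj r U i k * U k l) * cnj (U i l))"
      by (rule sum_mult_compl_proj[OF that])
    also have "(\<Sum>k<d. compl_proj r U i k * U k l) = 0" if "l < r" for l
    proof -
      have "(\<Sum>k<d. compl_proj r U i k * U k l) = cnj (\<Sum>k<d. cnj (U k l) * compl_proj r U k i)"
        by (simp add: cnj_compl_proj mult.commute)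
      then show ?thesis using compl_proj_orthogonal[OF U \<open>i < d\<close> that] by simp
    qed
    then have "(\<Sum>l<r. (\<Sum>k<d. compl_proj r U i k * U k l) * cnj (U i l)) = 0" by simp
    finally have "compl_proj r U i i = (\<Sum>k<d. complex_of_real ((cmod (compl_proj r U i k))\<^sup>2))"
      by (simp only: complex_norm_square cnj_compl_proj) simp
    then show ?thesis by (simp add: sum_nonneg)
  qed
  then have "0 \<le> (\<Sum>i<d. Re (compl_proj r U i i))" by (intro sum_nonneg) simp
  also have "\<dots> = Re (\<Sum>i<d. 1 - (\<Sum>k<r. cnj (U i k) * U i k))"
    by (simp add: compl_proj_def mult.commute)
  also have "(\<Sum>i<d. 1 - (\<Sum>k<r. cnj (U i k) * U i k)) =
      of_nat d - (\<Sum>k<r. \<Sum>i<d. cnj (U i k) * U i k)"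
    by (subst sum.swap) (simp add: sum_subtractf)
  also have "(\<Sum>k<r. \<Sum>i<d. cnj (U i k) * U i k) = (\<Sum>k<r. 1)"
    using U by (intro sum.cong refl) (simp add: orthonormal_def)
  finally show ?thesis by simp
qed

text \<open>Only positive eigenvalues are recorded, so \<open>r\<close> may be smaller than
  \<open>d\<close>. The empty system with \<open>r = 0\<close> is allowed and starts the search for
  a maximal one.\<close>

definition eigensystem ::
  "nat \<Rightarrow> (nat \<Rightarrow> nat \<Rightarrow> complex) \<Rightarrow> nat \<Rightarrow> (nat \<Rightarrow> nat \<Rightarrow> complex) \<Rightarrow> (nat \<Rightarrow> real) \<Rightarrow> bool" where
  "eigensystem d A r U lam \<longleftrightarrow> orthonormal d r U \<and> (\<forall>k<r. 0 < lam k) \<and>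
     (\<forall>k<r. \<forall>i<d. (\<Sum>j<d. A i j * U j k) = of_real (lam k) * U i k)"

lemma sum_cnj_mult_self: "(\<Sum>i<d. cnj (v i) * v i) = of_real (\<Sum>i<d. (cmod (v i))\<^sup>2)"
  by (simp add: complex_norm_square mult.commute del: of_real_power)

text \<open>Compress \<open>A\<close> to the complement of the eigenvectors found so far. As long as the
  compression has nonzero trace, it has an eigenvector for a nonzero eigenvalue, which is then
  orthogonal to its null vectors and an eigenvector of \<open>A\<close>.\<close>

lemma eigensystem_extend:
  assumes A: "psd_fun d A" and E: "eigensystem d A r U lam"
    and tr: "(\<Sum>j<d. qform d A (\<lambda>i. compl_proj r U i j)) \<noteq> 0"
  shows "\<exists>U' lam'. eigensystem d A (Suc r) U' lam'"
proof -
  let ?W = "compl_proj r U"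
  have U: "orthonormal d r U" and lam: "\<And>k. k < r \<Longrightarrow> 0 < lam k"
    and AU: "\<And>k i. k < r \<Longrightarrow> i < d \<Longrightarrow> (\<Sum>j<d. A i j * U j k) = of_real (lam k) * U i k"
    using E by (auto simp: eigensystem_def)
  define B where "B = congr d ?W A"
  have "(\<Sum>j<d. B j j) \<noteq> 0" using tr by (simp add: B_def congr_def qform_def)
  then obtain \<mu> v where \<mu>: "\<mu> \<noteq> 0" and v1: "(\<Sum>i<d. (cmod (v i))\<^sup>2) = 1"
    and Bv: "\<And>i. i < d \<Longrightarrow> (\<Sum>j<d. B i j * v j) = \<mu> * v i"
    using exists_nonzero_eigenvector[of B d] by blast
  \<comment> \<open>\<open>U\<^sup>* W = 0\<close> forces \<open>U\<^sup>* B = 0\<close> for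
    \<open>B = W A W\<close>; hence \<open>\<mu> U\<^sup>* v = U\<^sup>* B v = 0\<close>, and
    \<open>\<mu>\<close> is nonzero.\<close>
  have Uv: "(\<Sum>i<d. cnj (U i k) * v i) = 0" if "k < r" for k
  proof -
    have "(\<Sum>i<d. cnj (U i k) * B i j) = 0" for j
    proof -
      have "(\<Sum>i<d. cnj (U i k) * B i j) =
          (\<Sum>i<d. \<Sum>p<d. \<Sum>q<d. cnj (U i k) * ?W i p * (A p q * ?W q j))"
        by (simp add: B_def congr_def cnj_compl_proj sum_distrib_left mult.assoc)
      also have "\<dots> = (\<Sum>p<d. \<Sum>q<d. (\<Sum>i<d. cnj (U i k) * ?W i p) * (A p q * ?W q j))"
        by (subst sum_rotate3) (simp add: sum_distrib_right)
      also have "\<dots> = 0" using compl_proj_orthogonal[OF U _ that] by simp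
      finally show ?thesis .
    qed
    then have "0 = (\<Sum>j<d. (\<Sum>i<d. cnj (U i k) * B i j) * v j)" by simp
    also have "\<dots> = (\<Sum>i<d. cnj (U i k) * (\<Sum>j<d. B i j * v j))"
      by (simp add: sum_distrib_left sum_distrib_right mult.assoc) (rule sum.swap)
    also have "\<dots> = \<mu> * (\<Sum>i<d. cnj (U i k) * v i)"
      by (simp add: Bv sum_distrib_left mult.left_commute)
    finally show ?thesis using \<mu> by simp
  qed
  have Wv: "(\<Sum>j<d. ?W i j * v j) = v i" if "i < d" for i
  proof -
    have "(\<Sum>j<d. ?W i j * v j) = cnj (\<Sum>j<d. cnj (v j) * ?W j i)"
      by (simp add: cnj_compl_proj mult.commute)
    also have "\<dots> = v i - (\<Sum>k<r. cnj (\<Sum>j<d. cnj (v j) * U j k) * U i k)"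
      by (simp add: sum_mult_compl_proj[OF that])
    also have "\<dots> = v i"
      using Uv by (simp add: mult.commute)
    finally show ?thesis .
  qed
  define w where "w i = (\<Sum>j<d. A i j * v j)" for i
  \<comment> \<open>The complement of the eigenvectors is invariant under \<open>A\<close>, because
    \<open>A\<close> is Hermitian.\<close>
  have Uw: "(\<Sum>i<d. cnj (U i k) * w i) = 0" if "k < r" for k
  proof -
    have "(\<Sum>i<d. cnj (U i k) * w i) = (\<Sum>j<d. \<Sum>i<d. cnj (U i k) * A i j * v j)"
      by (simp add: w_def sum_distrib_left mult.assoc) (rule sum.swap)
    also have "\<dots> = (\<Sum>j<d. cnj (\<Sum>i<d. A j i * U i k) * v j)"
      using psd_fun_sym[OF A] by (simp add: sum_distrib_left sum_distrib_right mult_ac)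
    also have "\<dots> = (\<Sum>j<d. of_real (lam k) * cnj (U j k) * v j)"
      using that by (simp add: AU)
    also have "\<dots> = of_real (lam k) * (\<Sum>j<d. cnj (U j k) * v j)"
      by (simp add: sum_distrib_left mult.assoc)
    finally show ?thesis using Uv[OF that] by simp
  qed
  \<comment> \<open>\<open>\<mu> v = W A W v = W A v = A v\<close>, since \<open>W\<close> fixes
    both \<open>v\<close> and \<open>w = A v\<close>.\<close>
  have Av: "(\<Sum>j<d. A i j * v j) = \<mu> * v i" if "i < d" for i
  proof -
    have "\<mu> * v i = (\<Sum>j<d. \<Sum>p<d. \<Sum>q<d. cnj (?W p i) * A p q * (?W q j * v j))"
      unfolding Bv[OF that, symmetric] by (simp add: B_def congr_def sum_distrib_right mult.assoc)
    also have "\<dots> = (\<Sum>p<d. \<Sum>q<d. cnj (?W p i) * A p q * (\<Sum>j<d. ?W q j * v j))"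
      by (subst sum_rotate3) (simp add: sum_distrib_left)
    also have "\<dots> = (\<Sum>p<d. cnj (?W p i) * w p)"
      by (simp add: Wv w_def sum_distrib_left mult.assoc)
    also have "\<dots> = cnj (\<Sum>p<d. cnj (w p) * ?W p i)"
      by (simp add: mult.commute)
    also have "\<dots> = w i - (\<Sum>k<r. cnj (\<Sum>j<d. cnj (w j) * U j k) * U i k)"
      by (simp add: sum_mult_compl_proj[OF that])
    also have "\<dots> = w i"
      using Uw by (simp add: mult.commute)
    finally show ?thesis by (simp add: w_def)
  qed
  \<comment> \<open>At a unit eigenvector the form equals the eigenvalue, which positivity of
    \<open>A\<close> makes real and nonnegative.\<close>
  have "qform d A v = (\<Sum>i<d. cnj (v i) * (\<Sum>j<d. A i j * v j))"
    by (simp add: qform_def sum_distrib_left mult.assoc)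
  also have "\<dots> = (\<Sum>i<d. cnj (v i) * (\<mu> * v i))"
    by (simp add: Av)
  also have "\<dots> = \<mu> * (\<Sum>i<d. cnj (v i) * v i)"
    by (simp add: sum_distrib_left mult.left_commute)
  finally have "qform d A v = \<mu>" by (simp add: sum_cnj_mult_self v1)
  with psd_fun_qform_nonneg[OF A, of v] have "0 \<le> \<mu>" by simp
  with \<mu> have \<mu>R: "\<mu> = of_real (Re \<mu>)" "0 < Re \<mu>"
    by (auto simp: less_eq_complex_def complex_eq_iff less_le)
  have vU: "(\<Sum>i<d. cnj (v i) * U i k) = 0" if "k < r" for k
  proof -
    have "(\<Sum>i<d. cnj (v i) * U i k) = cnj (\<Sum>i<d. cnj (U i k) * v i)"
      by (simp add: mult.commute)
    then show ?thesis using Uv[OF that] by simp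
  qed
  have vv: "(\<Sum>i<d. cnj (v i) * v i) = 1" by (simp add: sum_cnj_mult_self v1)
  have "eigensystem d A (Suc r) (\<lambda>i k. if k = r then v i else U i k) (lam(r := Re \<mu>))"
    unfolding eigensystem_def orthonormal_def
  proof (intro conjI allI impI)
    fix k l assume "k < Suc r" "l < Suc r"
    then show "(\<Sum>i<d. cnj (if k = r then v i else U i k) * (if l = r then v i else U i l)) =
        of_bool (k = l)"
      using U vU Uv vv by (auto simp: less_Suc_eq orthonormal_def)
  next
    fix k assume "k < Suc r"
    then show "0 < (lam(r := Re \<mu>)) k" using lam \<mu>R by auto
  next
    fix k i assume "k < Suc r" "i < d"
    then show "(\<Sum>j<d. A i j * (if k = r then v j else U j k)) =
        complex_of_real ((lam(r := Re \<mu>)) k) * (if k = r then v i else U i k)"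
      using AU Av \<mu>R(1) by auto
  qed
  then show ?thesis by blast
qed

text \<open>Take an eigensystem of maximal size, which exists since sizes are at most
  \<open>d\<close>. It cannot be extended, so the compression of \<open>A\<close> to the complement
  has trace 0; its diagonal entries are nonnegative, hence all 0. Thus \<open>A W = 0\<close> for
  the complementary projection \<open>W\<close>, that is, \<open>A = A U U\<^sup>*\<close>.\<close>

lemma psd_fun_spectral:
  fixes A :: "nat \<Rightarrow> nat \<Rightarrow> complex"
  assumes A: "psd_fun d A"
  obtains r U lam where "eigensystem d A r U lam"
    "\<And>i j. i < d \<Longrightarrow> j < d \<Longrightarrow> A i j = (\<Sum>k<r. of_real (lam k) * U i k * cnj (U j k))"
proof -
  define R where "R = {r. \<exists>U lam. eigensystem d A r U lam}"
  have "R \<subseteq> {..d}" by (auto simp: R_def eigensystem_def dest: orthonormal_le)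
  then have fin: "finite R" by (rule finite_subset) simp
  have "0 \<in> R" by (simp add: R_def eigensystem_def orthonormal_def)
  define r where "r = Max R"
  have "r \<in> R" using fin \<open>0 \<in> R\<close> unfolding r_def by (intro Max_in) auto
  then obtain U lam where E: "eigensystem d A r U lam" by (auto simp: R_def)
  have "Suc r \<notin> R" using Max_ge[OF fin, of "Suc r"] by (auto simp: r_def)
  then have "(\<Sum>j<d. qform d A (\<lambda>i. compl_proj r U i j)) = 0"
    using eigensystem_extend[OF A E] by (auto simp: R_def)
  then have "(\<Sum>j<d. Re (qform d A (\<lambda>i. compl_proj r U i j))) = 0"
    by (metis Re_sum zero_complex.sel(1))
  then have "Re (qform d A (\<lambda>i. compl_proj r U i j)) = 0" if "j < d" for j
    using that psd_fun_qform_nonneg[OF A]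
    by (subst (asm) sum_nonneg_eq_0_iff) (auto simp: less_eq_complex_def)
  then have null: "qform d A (\<lambda>i. compl_proj r U i j) = 0" if "j < d" for j
    using that psd_fun_qform_nonneg[OF A, of "\<lambda>i. compl_proj r U i j"]
    by (simp add: less_eq_complex_def complex_eq_iff)
  have "A i j = (\<Sum>k<r. of_real (lam k) * U i k * cnj (U j k))" if "i < d" "j < d" for i j
    using psd_fun_null[OF A null[OF that(2)] that(1)] E that
    by (simp add: sum_mult_compl_proj[OF that(2)] eigensystem_def)
  with E that show ?thesis by blast
qed

section \<open>Compressions and the Hilbert-Schmidt product\<close>

lemma congr_cong:
  "(\<And>k l. k < d \<Longrightarrow> l < d \<Longrightarrow> A k l = B k l) \<Longrightarrow> congr d C A i j = congr d C B i j"
  by (simp add: congr_def)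

lemma congr_sum: "(\<Sum>a\<in>S. congr d C (M a) i j) = congr d C (\<lambda>k l. \<Sum>a\<in>S. M a k l) i j"
  unfolding congr_def by (subst sum_rotate3) (simp add: sum_distrib_left sum_distrib_right)

lemma congr_id: "congr d C (\<lambda>k l. of_bool (k = l)) i j = (\<Sum>k<d. cnj (C k i) * C k j)"
proof -
  have "(\<Sum>l<d. cnj (C k i) * of_bool (k = l) * C l j) = cnj (C k i) * C k j" if "k < d" for k
  proof -
    have "(\<Sum>l<d. cnj (C k i) * of_bool (k = l) * C l j) = (\<Sum>l<d. if l = k then cnj (C k i) * C l j else 0)"
      by (intro sum.cong) auto
    then show ?thesis using that by simp
  qed
  then show ?thesis by (simp add: congr_def)
qed

lemma congr_scale:
  "congr d (\<lambda>k i. U k i * of_real (e i)) A i j = of_real (e i * e j) * congr d U A i j"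
  by (simp add: congr_def sum_distrib_left mult_ac)

lemma congr_eigensystem:
  assumes "eigensystem d A r U lam" "i < r" "j < r"
  shows "congr d U A i j = of_real (lam j) * of_bool (i = j)"
proof -
  have "congr d U A i j = (\<Sum>k<d. cnj (U k i) * (\<Sum>l<d. A k l * U l j))"
    by (simp add: congr_def sum_distrib_left mult.assoc)
  also have "\<dots> = (\<Sum>k<d. cnj (U k i) * (of_real (lam j) * U k j))"
    using assms by (simp add: eigensystem_def)
  also have "\<dots> = of_real (lam j) * (\<Sum>k<d. cnj (U k i) * U k j)"
    by (simp add: sum_distrib_left mult.left_commute)
  also have "(\<Sum>k<d. cnj (U k i) * U k j) = of_bool (i = j)"
    using assms by (simp add: eigensystem_def orthonormal_def)
  finally show ?thesis .
qed

text \<open>The trace of \<open>A B\<^sup>*\<close>, that is, of \<open>A B\<close> for Hermitian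
  \<open>B\<close>.\<close>

definition hs :: "nat \<Rightarrow> (nat \<Rightarrow> nat \<Rightarrow> complex) \<Rightarrow> (nat \<Rightarrow> nat \<Rightarrow> complex) \<Rightarrow> complex" where
  "hs d A B = (\<Sum>i<d. \<Sum>j<d. A i j * cnj (B i j))"

text \<open>Expanding \<open>B\<close> in its eigenvectors gives a sum of eigenvalues times values
  of the form of \<open>A\<close>. This is why matrices in \<open>cone_CSplus\<close> are entrywise
  nonnegative.\<close>

lemma hs_nonneg:
  assumes A: "psd_fun d A" and B: "psd_fun d B"
  shows "0 \<le> hs d A B"
proof -
  obtain r U lam where E: "eigensystem d B r U lam"
    and BU: "\<And>i j. i < d \<Longrightarrow> j < d \<Longrightarrow> B i j = (\<Sum>k<r. of_real (lam k) * U i k * cnj (U j k))"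
    by (rule psd_fun_spectral[OF B]) blast
  have "hs d A B = (\<Sum>i<d. \<Sum>j<d. \<Sum>k<r. of_real (lam k) * (cnj (U i k) * A i j * U j k))"
    by (simp add: hs_def BU sum_distrib_left mult_ac)
  also have "\<dots> = (\<Sum>k<r. \<Sum>i<d. \<Sum>j<d. of_real (lam k) * (cnj (U i k) * A i j * U j k))"
    by (rule sum_rotate3[symmetric])
  also have "\<dots> = (\<Sum>k<r. of_real (lam k) * qform d A (\<lambda>i. U i k))"
    by (simp add: qform_def sum_distrib_left)
  also have "0 \<le> \<dots>"
    using E psd_fun_qform_nonneg[OF A]
    by (intro sum_nonneg mult_nonneg_nonneg) (auto simp: eigensystem_def less_eq_complex_def intro: less_imp_le)
  finally show ?thesis .
qed

text \<open>The form of the transpose at \<open>v\<close> is the form of \<open>A\<close> at the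
  conjugate of \<open>v\<close>.\<close>

lemma psd_fun_transpose:
  fixes A :: "nat \<Rightarrow> nat \<Rightarrow> complex"
  assumes A: "psd_fun d A"
  shows "psd_fun d (\<lambda>i j. A j i)"
  unfolding psd_fun_def
proof (intro conjI allI impI)
  fix v
  have "qform d (\<lambda>i j. A j i) v = qform d A (\<lambda>i. cnj (v i))"
    by (simp add: qform_def) (subst sum.swap, simp add: mult_ac)
  then show "0 \<le> qform d (\<lambda>i j. A j i) v" using psd_fun_qform_nonneg[OF A] by simp
qed (simp add: psd_fun_sym[OF A, unfolded conjugate_complex_def])

text \<open>The form of \<open>G G\<^sup>*\<close> at \<open>w\<close> is the squared norm of
  \<open>w\<^sup>* G\<close>. So it is nonnegative, and where it vanishes, so does
  \<open>w\<^sup>* G\<close>.\<close>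

lemma qform_gram:
  "qform d (\<lambda>i j. \<Sum>k<n. G i k * cnj (G j k)) w =
    of_real (\<Sum>k<n. (cmod (\<Sum>i<d. cnj (w i) * G i k))\<^sup>2)"
proof -
  have "qform d (\<lambda>i j. \<Sum>k<n. G i k * cnj (G j k)) w =
      (\<Sum>i<d. \<Sum>j<d. \<Sum>k<n. (cnj (w i) * G i k) * cnj (cnj (w j) * G j k))"
    by (simp add: qform_def sum_distrib_left sum_distrib_right mult_ac)
  also have "\<dots> = (\<Sum>k<n. (\<Sum>i<d. cnj (w i) * G i k) * cnj (\<Sum>j<d. cnj (w j) * G j k))"
    by (subst sum_rotate3[symmetric]) (simp add: sum_product)
  finally show ?thesis
    by (simp only: complex_norm_square of_real_sum)
qed

lemma psd_fun_gram: "psd_fun d (\<lambda>i j. \<Sum>k<n. G i k * cnj (G j k))"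
  unfolding psd_fun_def qform_gram
  by (auto simp: mult.commute less_eq_complex_def sum_nonneg simp del: of_real_sum)

text \<open>Compression to the eigenvectors preserves the Hilbert-Schmidt product with operators that
  vanish on their complement.\<close>

lemma hs_congr:
  assumes A: "psd_fun d A"
    and null: "\<And>j. j < d \<Longrightarrow> qform d A (\<lambda>i. compl_proj r U i j) = 0"
  shows "hs r (congr d U A) (congr d U B) = hs d A B"
proof -
  \<comment> \<open>\<open>A W = 0\<close> for \<open>W = I - U U\<^sup>*\<close> reads
    \<open>A = A U U\<^sup>*\<close>; taking adjoints gives
    \<open>A = U U\<^sup>* A\<close>.\<close>
  have right: "A i j = (\<Sum>q<r. (\<Sum>l<d. A i l * U l q) * cnj (U j q))" if "i < d" "j < d" for i j
    using psd_fun_null[OF A null[OF that(2)] that(1)] by (simp add: sum_mult_compl_proj[OF that(2)])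
  have left: "A i j = (\<Sum>p<r. U i p * (\<Sum>k<d. cnj (U k p) * A k j))" if "i < d" "j < d" for i j
  proof -
    have "A i j = cnj (A j i)" using psd_fun_sym[OF A that(2) that(1)] by simp
    also have "\<dots> = (\<Sum>p<r. U i p * (\<Sum>k<d. cnj (U k p) * cnj (A j k)))"
      by (subst right[OF that(2) that(1)]) (simp add: mult.commute)
    also have "\<dots> = (\<Sum>p<r. U i p * (\<Sum>k<d. cnj (U k p) * A k j))"
      using psd_fun_sym[OF A that(2)] by simp
    finally show ?thesis .
  qed
  \<comment> \<open>Both together say \<open>A = U (U\<^sup>* A U) U\<^sup>*\<close>; in the product
    with \<open>B\<close> the outer factors then move over to \<open>B\<close>.\<close>
  have rep: "A i j = (\<Sum>p<r. \<Sum>q<r. U i p * congr d U A p q * cnj (U j q))" if "i < d" "j < d" for i j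
  proof -
    have AU: "(\<Sum>l<d. A i l * U l q) = (\<Sum>p<r. U i p * congr d U A p q)" for q
    proof -
      have "(\<Sum>l<d. A i l * U l q) = (\<Sum>l<d. \<Sum>p<r. \<Sum>k<d. U i p * (cnj (U k p) * A k l * U l q))"
        using left[OF that(1)] by (simp add: sum_distrib_left sum_distrib_right mult.assoc)
      also have "\<dots> = (\<Sum>p<r. U i p * congr d U A p q)"
        by (subst sum_rotate3) (simp add: congr_def sum_distrib_left)
      finally show ?thesis .
    qed
    show ?thesis
      by (subst right[OF that]) (simp add: AU sum_distrib_right, rule sum.swap)
  qed
  have "hs d A B = (\<Sum>i<d. \<Sum>j<d. \<Sum>p<r. \<Sum>q<r.
      congr d U A p q * (U i p * cnj (B i j) * cnj (U j q)))"
    unfolding hs_def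
    by (intro sum.cong refl) (simp add: rep sum_distrib_left sum_distrib_right mult_ac)
  also have "\<dots> = (\<Sum>p<r. \<Sum>q<r. \<Sum>i<d. \<Sum>j<d.
      congr d U A p q * (U i p * cnj (B i j) * cnj (U j q)))"
    by (rule sum_swap_pairs)
  also have "\<dots> = hs r (congr d U A) (congr d U B)"
    by (simp add: hs_def congr_def[of d U B] sum_distrib_left)
  finally show ?thesis ..
qed

section \<open>Quadratic forms of Kronecker products\<close>

lemma sum_lessThan_mult:
  fixes f :: "nat \<Rightarrow> 'a::comm_monoid_add"
  shows "(\<Sum>p<m * n. f p) = (\<Sum>i<m. \<Sum>k<n. f (i * n + k))"
proof -
  have "sum f {i * n..<i * n + n} = (\<Sum>k<n. f (i * n + k))" for i
    using sum.shift_bounds_nat_ivl[of f 0 "i * n" n] by (simp add: atLeast0LessThan add.commute)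
  then show ?thesis using sum.nat_group[of f n m] by simp
qed

lemma kron_qform:
  assumes X: "X \<in> carrier_mat m m" and Y: "Y \<in> carrier_mat n n" and \<psi>: "\<psi> \<in> carrier_vec (m * n)"
  shows "(kron X Y *\<^sub>v \<psi>) \<bullet>c \<psi> =
    (\<Sum>i<m. \<Sum>k<n. \<Sum>j<m. \<Sum>l<n. cnj (vec_index \<psi> (i * n + k)) *
      (X $$ (i,j) * Y $$ (k,l)) * vec_index \<psi> (j * n + l))"
proof -
  have bound: "i * n + k < m * n" if "i < m" "k < n" for i k
  proof -
    have "i * n + k < (i + 1) * n" using that by simp
    also have "\<dots> \<le> m * n" using that by (intro mult_le_mono1) simp
    finally show ?thesis .
  qed
  have "kron X Y \<in> carrier_mat (m * n) (m * n)" using X Y by (simp add: kron_def)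
  then have "(kron X Y *\<^sub>v \<psi>) \<bullet>c \<psi> = qform (m * n) (\<lambda>i j. kron X Y $$ (i,j)) (vec_index \<psi>)"
    using \<psi> by (rule qform_mat)
  also have "\<dots> = (\<Sum>i<m. \<Sum>k<n. \<Sum>j<m. \<Sum>l<n. cnj (vec_index \<psi> (i * n + k)) *
      (X $$ (i,j) * Y $$ (k,l)) * vec_index \<psi> (j * n + l))"
    unfolding qform_def sum_lessThan_mult
    using X Y by (intro sum.cong refl) (simp add: kron_def bound)
  finally show ?thesis .
qed

section \<open>Correlations and feasible matrices\<close>

lemma block_sum_eq:
  "block_sum (Inl s) (Inl s') X = (\<Sum>a\<in>UNIV. \<Sum>a'\<in>UNIV. X $ Inl (s, a) $ Inl (s', a'))"
  "block_sum (Inl s) (Inr t) X = (\<Sum>a\<in>UNIV. \<Sum>b\<in>UNIV. X $ Inl (s, a) $ Inr (t, b))"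
  "block_sum (Inr t) (Inl s) X = (\<Sum>b\<in>UNIV. \<Sum>a\<in>UNIV. X $ Inr (t, b) $ Inl (s, a))"
  "block_sum (Inr t) (Inr t') X = (\<Sum>b\<in>UNIV. \<Sum>b'\<in>UNIV. X $ Inr (t, b) $ Inr (t', b'))"
  unfolding block_sum_def by (simp_all add: sum.reindex inj_on_def)

lemma sum_UNIV_sum_type:
  fixes f :: "'a::finite + 'b::finite \<Rightarrow> 'c::comm_monoid_add"
  shows "(\<Sum>i\<in>UNIV. f i) = (\<Sum>a\<in>UNIV. f (Inl a)) + (\<Sum>b\<in>UNIV. f (Inr b))"
  by (simp add: UNIV_Plus_UNIV[symmetric] sum.Plus del: UNIV_Plus_UNIV)

lemma sum_UNIV_prod_type:
  fixes f :: "'a::finite \<times> 'b::finite \<Rightarrow> 'c::comm_monoid_add"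
  shows "(\<Sum>u\<in>UNIV. f u) = (\<Sum>a\<in>UNIV. \<Sum>b\<in>UNIV. f (a, b))"
  by (simp add: UNIV_Times_UNIV[symmetric] sum.cartesian_product del: UNIV_Times_UNIV)

text \<open>The cost matrix vanishes on the diagonal blocks, and by symmetry of \<open>X\<close> its
  two off-diagonal blocks contribute the same sum, each with the factor 1/2.\<close>

lemma trace_sym_cost_mat:
  fixes X :: "('a::finite, 'b::finite, 's::finite, 't::finite) sqmat"
  assumes "transpose X = X"
  shows "trace (sym_cost_mat \<pi> V ** X) =
    (\<Sum>s\<in>UNIV. \<Sum>t\<in>UNIV. pmf \<pi> (s,t) *
      (\<Sum>a\<in>UNIV. \<Sum>b\<in>UNIV. of_bool (V a b s t) * X $ Inl (s,a) $ Inr (t,b)))"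
    (is "_ = ?R")
proof -
  let ?c = "\<lambda>s a t b. pmf \<pi> (s,t) * of_bool (V a b s t) * X $ Inl (s,a) $ Inr (t,b)"
  have sym: "X $ u $ v = X $ v $ u" for u v
    using assms by (metis (no_types, lifting) transpose_def vec_lambda_beta)
  have "trace (sym_cost_mat \<pi> V ** X) =
      (\<Sum>u\<in>UNIV. \<Sum>v\<in>UNIV. sym_cost_mat \<pi> V $ u $ v * X $ u $ v)"
    unfolding trace_def matrix_matrix_mult_def by (simp add: sym)
  also have "\<dots> = (\<Sum>s\<in>UNIV. \<Sum>a\<in>UNIV. \<Sum>t\<in>UNIV. \<Sum>b\<in>UNIV. ?c s a t b / 2)
      + (\<Sum>t\<in>UNIV. \<Sum>b\<in>UNIV. \<Sum>s\<in>UNIV. \<Sum>a\<in>UNIV. ?c s a t b / 2)"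
    unfolding sum_UNIV_sum_type sum_UNIV_prod_type sym_cost_mat_def cost_mat_def
    by (simp add: transpose_def sym[of "Inr _" "Inl _"])
  also have "(\<Sum>t\<in>UNIV. \<Sum>b\<in>UNIV. \<Sum>s\<in>UNIV. \<Sum>a\<in>UNIV. ?c s a t b / 2) =
      (\<Sum>s\<in>UNIV. \<Sum>t\<in>UNIV. \<Sum>a\<in>UNIV. \<Sum>b\<in>UNIV. ?c s a t b / 2)"
  proof -
    have "(\<Sum>t\<in>UNIV. \<Sum>b\<in>UNIV. \<Sum>s\<in>UNIV. \<Sum>a\<in>UNIV. ?c s a t b / 2) =
        (\<Sum>t\<in>UNIV. \<Sum>s\<in>UNIV. \<Sum>b\<in>UNIV. \<Sum>a\<in>UNIV. ?c s a t b / 2)"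
      by (intro sum.cong[OF refl] sum.swap)
    also have "\<dots> = (\<Sum>s\<in>UNIV. \<Sum>t\<in>UNIV. \<Sum>b\<in>UNIV. \<Sum>a\<in>UNIV. ?c s a t b / 2)"
      by (rule sum.swap)
    also have "\<dots> = (\<Sum>s\<in>UNIV. \<Sum>t\<in>UNIV. \<Sum>a\<in>UNIV. \<Sum>b\<in>UNIV. ?c s a t b / 2)"
      by (intro sum.cong[OF refl] sum.swap)
    finally show ?thesis .
  qed
  also have "(\<Sum>s\<in>UNIV. \<Sum>a\<in>UNIV. \<Sum>t\<in>UNIV. \<Sum>b\<in>UNIV. ?c s a t b / 2) =
      (\<Sum>s\<in>UNIV. \<Sum>t\<in>UNIV. \<Sum>a\<in>UNIV. \<Sum>b\<in>UNIV. ?c s a t b / 2)"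
    by (intro sum.cong[OF refl] sum.swap)
  finally show ?thesis
    by (simp add: sum_distrib_left sum_divide_distrib[symmetric] mult.assoc
      del: sum_of_bool_mult_eq sum_mult_of_bool_eq)
qed

text \<open>The objective depends only on the block of \<open>X\<close> between \<open>Inl\<close>
  and \<open>Inr\<close>. If these blocks of feasible matrices are exactly the correlations in
  \<open>R\<close>, both suprema range over the same numbers.\<close>

lemma game_value_eq_conic_value:
  fixes R :: "('a::finite, 'b::finite, 's::finite, 't::finite) correlation set"
  assumes sym: "\<And>X. X \<in> K \<Longrightarrow> transpose X = X"
    and fwd: "\<And>p. p \<in> R \<Longrightarrow> \<exists>X\<in>K. (\<forall>i j. block_sum i j X = 1) \<and>
      (\<forall>a b s t. p a b s t = X $ Inl (s,a) $ Inr (t,b))"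
    and bwd: "\<And>X. X \<in> K \<Longrightarrow> \<forall>i j. block_sum i j X = 1 \<Longrightarrow>
      (\<lambda>a b s t. X $ Inl (s,a) $ Inr (t,b)) \<in> R"
  shows "game_value R \<pi> V = conic_value K \<pi> V"
  unfolding game_value_def conic_value_def
proof (intro antisym SUP_least)
  fix p assume "p \<in> R"
  from fwd[OF this] obtain X where X: "X \<in> K" "\<forall>i j. block_sum i j X = 1"
    and p: "\<And>a b s t. p a b s t = X $ Inl (s,a) $ Inr (t,b)" by blast
  show "ereal (\<Sum>s\<in>UNIV. \<Sum>t\<in>UNIV. pmf \<pi> (s,t) *
        (\<Sum>a\<in>UNIV. \<Sum>b\<in>UNIV. of_bool (V a b s t) * p a b s t))
    \<le> (SUP X\<in>{X\<in>K. \<forall>i j. block_sum i j X = 1}. ereal (trace (sym_cost_mat \<pi> V ** X)))"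
    by (rule SUP_upper2[of X]) (use X in \<open>simp_all add: p trace_sym_cost_mat sym\<close>)
next
  fix X assume X: "X \<in> {X\<in>K. \<forall>i j. block_sum i j X = 1}"
  show "ereal (trace (sym_cost_mat \<pi> V ** X)) \<le> (SUP p\<in>R. ereal
     (\<Sum>s\<in>UNIV. \<Sum>t\<in>UNIV. pmf \<pi> (s,t) *
        (\<Sum>a\<in>UNIV. \<Sum>b\<in>UNIV. of_bool (V a b s t) * p a b s t)))"
    by (rule SUP_upper2[OF bwd[of X]]) (use X in \<open>simp_all add: trace_sym_cost_mat sym\<close>)
qed

lemma feasible_in_corr_P:
  fixes X :: "('a::finite, 'b::finite, 's::finite, 't::finite) sqmat"
  assumes "\<And>u v. 0 \<le> X $ u $ v" and "\<And>i j. block_sum i j X = 1"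
  shows "(\<lambda>a b s t. X $ Inl (s,a) $ Inr (t,b)) \<in> corr_P"
  using assms(1) assms(2)[of "Inl _" "Inr _"] by (simp add: corr_P_def block_sum_eq)

text \<open>The diagonal blocks hold the product of the uniform distribution on the answers with
  itself, which has total mass 1.\<close>

definition product_completion ::
  "('a::finite, 'b::finite, 's::finite, 't::finite) correlation \<Rightarrow> ('a, 'b, 's, 't) sqmat" where
  "product_completion p = (\<chi> u v. case (u, v) of
      (Inl (s,a), Inr (t,b)) \<Rightarrow> p a b s t
    | (Inr (t,b), Inl (s,a)) \<Rightarrow> p a b s t
    | (Inl _, Inl _) \<Rightarrow> 1 / (real CARD('a))\<^sup>2
    | (Inr _, Inr _) \<Rightarrow> 1 / (real CARD('b))\<^sup>2)"

lemma product_completion_Inl_Inr [simp]: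
  "product_completion p $ Inl (s,a) $ Inr (t,b) = p a b s t"
  by (simp add: product_completion_def)

lemma product_completion_feasible:
  fixes p :: "('a::finite, 'b::finite, 's::finite, 't::finite) correlation"
  assumes "p \<in> corr_P"
  shows "product_completion p \<in> cone_N" and "block_sum i j (product_completion p) = 1"
proof -
  show "product_completion p \<in> cone_N"
  proof -
    have "product_completion p $ u $ v = product_completion p $ v $ u" for u v
      by (simp add: product_completion_def split: sum.split prod.split)
    then have "transpose (product_completion p) = product_completion p"
      by (simp add: transpose_def vec_eq_iff)
    moreover have "0 \<le> product_completion p $ u $ v" for u v
      using assms by (simp add: corr_P_def product_completion_def split: sum.split prod.split)
    ultimately show ?thesis by (simp add: cone_N_def)
  qed
  have "(\<Sum>a\<in>UNIV. \<Sum>b\<in>UNIV. p a b s t) = 1" for s t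
    using assms by (simp add: corr_P_def)
  moreover from this have "(\<Sum>b\<in>UNIV. \<Sum>a\<in>UNIV. p a b s t) = 1" for s t
    by (subst sum.swap)
  ultimately show "block_sum i j (product_completion p) = 1"
    by (cases i; cases j) (simp_all add: block_sum_eq product_completion_def power2_eq_square)
qed

section \<open>The unrestricted and the no-signaling value\<close>

lemma unrestricted_value: "game_value corr_P \<pi> V = conic_value cone_N \<pi> V"
proof (rule game_value_eq_conic_value)
  fix p :: "('a, 'b, 'c, 'd) correlation" assume "p \<in> corr_P"
  then show "\<exists>X\<in>cone_N. (\<forall>i j. block_sum i j X = 1) \<and>
      (\<forall>a b s t. p a b s t = X $ Inl (s,a) $ Inr (t,b))"
    by (intro bexI[of _ "product_completion p"]) (simp_all add: product_completion_feasible)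
qed (simp_all add: feasible_in_corr_P cone_N_def)

text \<open>The conditions that \<open>cone_NSO\<close> adds to \<open>cone_N\<close> concern only
  the off-diagonal block, where they are those of \<open>corr_NS\<close>.\<close>

lemma no_signaling_value: "game_value corr_NS \<pi> V = conic_value cone_NSO \<pi> V"
proof (rule game_value_eq_conic_value)
  fix p :: "('a, 'b, 'c, 'd) correlation" assume p: "p \<in> corr_NS"
  then have "p \<in> corr_P" by (simp add: corr_NS_def)
  with p show "\<exists>X\<in>cone_NSO. (\<forall>i j. block_sum i j X = 1) \<and>
      (\<forall>a b s t. p a b s t = X $ Inl (s,a) $ Inr (t,b))"
    by (intro bexI[of _ "product_completion p"])
      (auto simp: product_completion_feasible cone_NSO_def corr_NS_def)
next
  fix X :: "('a, 'b, 'c, 'd) sqmat" assume "X \<in> cone_NSO" "\<forall>i j. block_sum i j X = 1"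
  then show "(\<lambda>a b s t. X $ Inl (s,a) $ Inr (t,b)) \<in> corr_NS"
    by (simp add: corr_NS_def cone_NSO_def cone_N_def feasible_in_corr_P)
qed (simp add: cone_NSO_def cone_N_def)

text \<open>Two unit vectors with inner product 1 coincide, so all blocks of a feasible Gram matrix have
  the same vector sum.\<close>

lemma gram_feasible_imp_common_block_sum:
  fixes X :: "('a::finite, 'b::finite, 's::finite, 't::finite) sqmat"
  assumes X: "X = (\<chi> u v. \<Sum>x\<in>I. g u x * g v x)" and "finite I"
    and feas: "\<And>i j. block_sum i j X = 1"
  obtains \<xi> where "\<And>i x. x \<in> I \<Longrightarrow> (\<Sum>u\<in>block i. g u x) = \<xi> x" and "(\<Sum>x\<in>I. (\<xi> x)\<^sup>2) = 1"
proof -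
  define h where "h i x = (\<Sum>u\<in>block i. g u x)" for i x
  have h: "(\<Sum>x\<in>I. h i x * h j x) = 1" for i j
  proof -
    have "(\<Sum>x\<in>I. h i x * h j x) = (\<Sum>x\<in>I. \<Sum>u\<in>block i. \<Sum>v\<in>block j. g u x * g v x)"
      by (simp add: h_def sum_product)
    also have "\<dots> = (\<Sum>u\<in>block i. \<Sum>v\<in>block j. \<Sum>x\<in>I. g u x * g v x)"
      by (rule sum_rotate3)
    also have "\<dots> = 1" using feas[of i j] by (simp add: block_sum_def X)
    finally show ?thesis .
  qed
  have eq: "h i x = h j x" if "x \<in> I" for i j x
  proof -
    have "(\<Sum>x\<in>I. (h i x - h j x)\<^sup>2) =
        (\<Sum>x\<in>I. h i x * h i x) - 2 * (\<Sum>x\<in>I. h i x * h j x) + (\<Sum>x\<in>I. h j x * h j x)"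
      by (simp add: power2_eq_square algebra_simps sum.distrib sum_subtractf sum_distrib_left)
    also have "\<dots> = 0" by (simp add: h)
    finally show ?thesis using that \<open>finite I\<close> by (simp add: sum_nonneg_eq_0_iff)
  qed
  show ?thesis
  \<comment> \<open>All \<open>h i\<close> agree on \<open>I\<close>, so any question may stand for
    the common sum; \<open>undefined\<close> names one.\<close>
  proof (rule that[of "h (Inl undefined)"])
    show "(\<Sum>u\<in>block i. g u x) = h (Inl undefined) x" if "x \<in> I" for i x
      using eq[OF that] unfolding h_def .
    show "(\<Sum>x\<in>I. (h (Inl undefined) x)\<^sup>2) = 1"
      using h by (simp add: power2_eq_square)
  qed
qed

text \<open>Every block sum equals the squared norm of \<open>\<xi>\<close>, and one off-diagonal
  block sums to a total probability, which is 1.\<close>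

lemma common_block_sum_imp_gram_feasible:
  fixes X :: "('a::finite, 'b::finite, 's::finite, 't::finite) sqmat"
  assumes X: "X = (\<chi> u v. \<Sum>x\<in>I. g u x * g v x)"
    and g: "\<And>i x. x \<in> I \<Longrightarrow> (\<Sum>u\<in>block i. g u x) = \<xi> x"
    and P: "(\<lambda>a b s t. X $ Inl (s,a) $ Inr (t,b)) \<in> corr_P"
  shows "block_sum i j X = 1" and "(\<Sum>x\<in>I. (\<xi> x)\<^sup>2) = 1"
proof -
  have *: "block_sum i j X = (\<Sum>x\<in>I. (\<xi> x)\<^sup>2)" for i j
  proof -
    have "block_sum i j X = (\<Sum>u\<in>block i. \<Sum>v\<in>block j. \<Sum>x\<in>I. g u x * g v x)"
      by (simp add: block_sum_def X)
    also have "\<dots> = (\<Sum>x\<in>I. \<Sum>u\<in>block i. \<Sum>v\<in>block j. g u x * g v x)"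
      by (rule sum_rotate3[symmetric])
    also have "\<dots> = (\<Sum>x\<in>I. (\<xi> x)\<^sup>2)"
      by (simp add: sum_product[symmetric] g power2_eq_square)
    finally show ?thesis .
  qed
  have "block_sum (Inl undefined) (Inr undefined) X = 1"
    using P by (simp add: block_sum_eq corr_P_def)
  then show "(\<Sum>x\<in>I. (\<xi> x)\<^sup>2) = 1" by (simp add: *)
  then show "block_sum i j X = 1" by (simp add: *)
qed

section \<open>The classical value\<close>

lemma sum_block:
  "sum f (block (Inl s)) = (\<Sum>a\<in>UNIV. f (Inl (s, a)))"
  "sum f (block (Inr t)) = (\<Sum>b\<in>UNIV. f (Inr (t, b)))"
  by (simp_all add: sum.reindex inj_on_def)

text \<open>The weight \<open>k i\<close> is split evenly: both players' strategies are scaled by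
  \<open>sqrt (k i)\<close>, so products carry the weight \<open>k i\<close> and every block adds up
  to \<open>sqrt (k i)\<close> in component \<open>i\<close>.\<close>

lemma corr_C_imp_cone_CP:
  fixes p :: "('a::finite, 'b::finite, 's::finite, 't::finite) correlation"
  assumes "p \<in> corr_C"
  shows "\<exists>X\<in>cone_CP. (\<forall>i j. block_sum i j X = 1) \<and>
      (\<forall>a b s t. p a b s t = X $ Inl (s,a) $ Inr (t,b))"
proof -
  obtain n :: nat and k x y where
    *: "\<forall>i<n. 0 \<le> k i \<and> (\<forall>s a. 0 \<le> x s a i) \<and> (\<forall>t b. 0 \<le> y t b i)"
      "\<forall>i<n. (\<forall>s. (\<Sum>a\<in>UNIV. x s a i) = 1) \<and> (\<forall>t. (\<Sum>b\<in>UNIV. y t b i) = 1)"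
    and k1: "(\<Sum>i<n. k i) = 1"
    and p: "\<forall>a b s t. p a b s t = (\<Sum>i<n. k i * x s a i * y t b i)"
    using assms unfolding corr_C_def by blast
  have nn: "\<And>i. i < n \<Longrightarrow> 0 \<le> k i"
      "\<And>i s a. i < n \<Longrightarrow> 0 \<le> x s a i" "\<And>i t b. i < n \<Longrightarrow> 0 \<le> y t b i"
    and x1: "\<And>i s. i < n \<Longrightarrow> (\<Sum>a\<in>UNIV. x s a i) = 1"
    and y1: "\<And>i t. i < n \<Longrightarrow> (\<Sum>b\<in>UNIV. y t b i) = 1"
    using * by auto
  define g where "g u i = sqrt (k i) * (case u of Inl (s,a) \<Rightarrow> x s a i | Inr (t,b) \<Rightarrow> y t b i)"
    for u :: "('a, 'b, 's, 't) idx" and i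
  define X :: "('a, 'b, 's, 't) sqmat" where "X = (\<chi> u v. \<Sum>i<n. g u i * g v i)"
  have pX: "p a b s t = X $ Inl (s,a) $ Inr (t,b)" for a b s t
  proof -
    have "g (Inl (s,a)) i * g (Inr (t,b)) i = k i * x s a i * y t b i" if "i < n" for i
      using nn(1)[OF that] real_sqrt_mult_self[of "k i"] by (simp add: g_def mult_ac)
    then show ?thesis by (simp add: p X_def)
  qed
  have "X \<in> cone_CP"
    unfolding cone_CP_def
  proof (intro CollectI exI[of _ n] exI[of _ "\<lambda>u. vec n (g u)"] conjI allI)
    show "1 \<le> n" using k1 by (cases n) auto
    show "0\<^sub>v n \<le> vec n (g u)" for u
      using nn by (auto simp: less_eq_vec_def g_def split: sum.split)
    show "X = (\<chi> u v. vec n (g u) \<bullet> vec n (g v))"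
      by (simp add: X_def scalar_prod_def atLeast0LessThan)
  qed simp
  moreover have "block_sum i j X = 1" for i j
  proof (rule common_block_sum_imp_gram_feasible[OF X_def])
    show "(\<Sum>u\<in>block i. g u l) = sqrt (k l)" if "l \<in> {..<n}" for i l
    proof (cases i)
      case (Inl s)
      have "(\<Sum>u\<in>block (Inl s). g u l) = sqrt (k l) * (\<Sum>a\<in>UNIV. x s a l)"
        unfolding sum_block by (simp add: g_def sum_distrib_left)
      then show ?thesis using that x1 Inl by simp
    next
      case (Inr t)
      have "(\<Sum>u\<in>block (Inr t). g u l) = sqrt (k l) * (\<Sum>b\<in>UNIV. y t b l)"
        unfolding sum_block by (simp add: g_def sum_distrib_left)
      then show ?thesis using that y1 Inr by simp
    qed
    show "(\<lambda>a b s t. X $ Inl (s,a) $ Inr (t,b)) \<in> corr_P"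
      using assms by (simp add: corr_C_def pX[symmetric])
  qed
  ultimately show ?thesis using pX by blast
qed

lemma cone_CP_imp_corr_C:
  fixes X :: "('a::finite, 'b::finite, 's::finite, 't::finite) sqmat"
  assumes "X \<in> cone_CP" and feas: "\<And>i j. block_sum i j X = 1"
  shows "(\<lambda>a b s t. X $ Inl (s,a) $ Inr (t,b)) \<in> corr_C"
proof -
  obtain d and x :: "('a, 'b, 's, 't) idx \<Rightarrow> real Matrix.vec"
    where "\<forall>u. x u \<in> carrier_vec d \<and> 0\<^sub>v d \<le> x u" and X: "X = (\<chi> u v. x u \<bullet> x v)"
    using assms(1) unfolding cone_CP_def by blast
  then have x: "\<And>u. x u \<in> carrier_vec d" "\<And>u. 0\<^sub>v d \<le> x u" by auto
  define g where "g u i = vec_index (x u) i" for u i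
  have g0: "0 \<le> g u i" if "i < d" for u i
    using x[of u] that by (auto simp: less_eq_vec_def g_def)
  have Xg: "X = (\<chi> u v. \<Sum>i\<in>{..<d}. g u i * g v i)"
    using carrier_vecD[OF x(1)] by (simp add: X scalar_prod_def g_def atLeast0LessThan)
  obtain \<xi> where \<xi>: "\<And>j i. i \<in> {..<d} \<Longrightarrow> (\<Sum>u\<in>block j. g u i) = \<xi> i"
    and \<xi>1: "(\<Sum>i<d. (\<xi> i)\<^sup>2) = 1"
    using gram_feasible_imp_common_block_sum[OF Xg _ feas] by blast
  have g\<xi>: "(\<Sum>a\<in>UNIV. g (Inl (s,a)) i) = \<xi> i" "(\<Sum>b\<in>UNIV. g (Inr (t,b)) i) = \<xi> i"
    if "i < d" for s t i
    using \<xi>[of i "Inl s"] \<xi>[of i "Inr t"] that by (simp_all only: sum_block lessThan_iff)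
  have \<xi>0: "0 \<le> \<xi> i" if "i < d" for i
    unfolding g\<xi>(1)[OF that, of undefined, symmetric] by (simp add: sum_nonneg g0 that)
  \<comment> \<open>Nonnegative entries with sum 0 vanish, so components with
    \<open>\<xi> i = 0\<close> contribute nothing to the correlation.\<close>
  have null: "g (Inl (s,a)) i = 0" if "i < d" "\<xi> i = 0" for s a i
    using g\<xi>(1)[OF that(1), of s] that g0 by (simp add: sum_nonneg_eq_0_iff)
  \<comment> \<open>The weights of a component with \<open>\<xi> i = 0\<close> are arbitrary, since it has probability 0.\<close>
  define f where "f c w i = (if \<xi> i = 0 then of_bool c else g w i / \<xi> i)" for c w i
  have "(\<lambda>a b s t. X $ Inl (s,a) $ Inr (t,b)) \<in> corr_P"
  proof (rule feasible_in_corr_P[OF _ feas])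
    show "0 \<le> X $ u $ v" for u v by (auto simp: Xg g0 intro!: sum_nonneg)
  qed
  moreover have "\<forall>i<d. 0 \<le> (\<xi> i)\<^sup>2 \<and> (\<forall>s a. 0 \<le> f (a = undefined) (Inl (s,a)) i) \<and>
      (\<forall>t b. 0 \<le> f (b = undefined) (Inr (t,b)) i)"
    by (simp add: f_def g0 \<xi>0)
  moreover have "(\<Sum>a\<in>UNIV. f (a = undefined) (Inl (s,a)) i) = 1"
    "(\<Sum>b\<in>UNIV. f (b = undefined) (Inr (t,b)) i) = 1" if "i < d" for s t i
    by (cases "\<xi> i = 0"; simp add: f_def sum_divide_distrib[symmetric] g\<xi> that)+
  moreover have "X $ Inl (s,a) $ Inr (t,b) =
      (\<Sum>i<d. (\<xi> i)\<^sup>2 * f (a = undefined) (Inl (s,a)) i * f (b = undefined) (Inr (t,b)) i)" for a b s t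
    by (auto simp: Xg f_def null power2_eq_square intro!: sum.cong)
  ultimately show ?thesis
    unfolding corr_C_def using \<xi>1
    by (intro CollectI conjI exI[of _ d] exI[of _ "\<lambda>i. (\<xi> i)\<^sup>2"]
        exI[of _ "\<lambda>s a. f (a = undefined) (Inl (s,a))"] exI[of _ "\<lambda>t b. f (b = undefined) (Inr (t,b))"])
      simp_all
qed

lemma classical_value: "game_value corr_C \<pi> V = conic_value cone_CP \<pi> V"
proof (rule game_value_eq_conic_value)
  fix X :: "('a, 'b, 'c, 'd) sqmat" assume "X \<in> cone_CP"
  then obtain d and x :: "('a, 'b, 'c, 'd) idx \<Rightarrow> real Matrix.vec"
    where "\<forall>u. x u \<in> carrier_vec d \<and> 0\<^sub>v d \<le> x u" and "X = (\<chi> u v. x u \<bullet> x v)"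
    unfolding cone_CP_def by blast
  then show "transpose X = X"
    by (simp add: transpose_def vec_eq_iff comm_scalar_prod[of _ d])
qed (simp_all add: corr_C_imp_cone_CP cone_CP_imp_corr_C)

section \<open>The quantum value\<close>

lemma psd_fun_sum:
  assumes "\<And>a. a \<in> S \<Longrightarrow> psd_fun d (M a)"
  shows "psd_fun d (\<lambda>i j. \<Sum>a\<in>S. M a i j :: complex)"
  unfolding psd_fun_def
proof (intro conjI allI impI)
  show "(\<Sum>a\<in>S. M a i j) = conjugate (\<Sum>a\<in>S. M a j i)" if "i < d" "j < d" for i j
    using psd_fun_sym[OF assms] that by simp
  fix v
  have "qform d (\<lambda>i j. \<Sum>a\<in>S. M a i j) v = (\<Sum>a\<in>S. qform d (M a) v)"
    unfolding qform_def by (subst sum_rotate3) (simp add: sum_distrib_left sum_distrib_right)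
  then show "0 \<le> qform d (\<lambda>i j. \<Sum>a\<in>S. M a i j) v"
    using psd_fun_qform_nonneg[OF assms] by (simp add: sum_nonneg)
qed

text \<open>The forms of the summands are nonnegative and add up to that of \<open>K\<close>, so all
  vanish where it does. Thus every operator of a block vanishes on the kernel of the block
  sum.\<close>

lemma psd_fun_null_summand:
  assumes M: "\<And>a. a \<in> S \<Longrightarrow> psd_fun d (M a)" and "finite S" "a \<in> S"
    and K: "\<And>i j. i < d \<Longrightarrow> j < d \<Longrightarrow> (\<Sum>a\<in>S. M a i j) = K i j"
    and null: "qform d K v = (0::complex)"
  shows "qform d (M a) v = 0"
proof -
  have "(\<Sum>a\<in>S. qform d (M a) v) = qform d (\<lambda>i j. \<Sum>a\<in>S. M a i j) v"
    unfolding qform_def by (subst sum_rotate3) (simp add: sum_distrib_left sum_distrib_right)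
  also have "\<dots> = 0" using null K by (simp cong: qform_cong)
  finally show ?thesis
    using psd_fun_qform_nonneg[OF M] \<open>finite S\<close> \<open>a \<in> S\<close> by (simp add: sum_nonneg_eq_0_iff)
qed

text \<open>The eigenvector equations turn \<open>A W = A - A U U\<^sup>*\<close> into the
  difference of \<open>A\<close> and its spectral expansion, which is 0.\<close>

lemma eigensystem_null:
  assumes E: "eigensystem d A r U lam"
    and A: "\<And>i j. i < d \<Longrightarrow> j < d \<Longrightarrow> A i j = (\<Sum>k<r. of_real (lam k) * U i k * cnj (U j k))"
    and "j < d"
  shows "qform d A (\<lambda>i. compl_proj r U i j) = 0"
proof -
  have "(\<Sum>l<d. A i l * compl_proj r U l j) = 0" if "i < d" for i
    using E that by (simp add: sum_mult_compl_proj[OF \<open>j < d\<close>] A[OF that \<open>j < d\<close>] eigensystem_def)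
  then show ?thesis
    by (simp add: qform_def mult.assoc sum_distrib_left[symmetric])
qed

lemma sum_hs: "(\<Sum>a\<in>S. \<Sum>b\<in>T. hs d (A a) (B b)) = hs d (\<lambda>i j. \<Sum>a\<in>S. A a i j) (\<lambda>i j. \<Sum>b\<in>T. B b i j)"
  unfolding hs_def by (subst sum_swap_pairs) (simp add: sum_product)

lemma hs_cong:
  "(\<And>i j. i < d \<Longrightarrow> j < d \<Longrightarrow> A i j = A' i j) \<Longrightarrow> (\<And>i j. i < d \<Longrightarrow> j < d \<Longrightarrow> B i j = B' i j) \<Longrightarrow>
    hs d A B = hs d A' B'"
  by (simp add: hs_def)

text \<open>The vector \<open>\<Sum>i. lam i e\<^sub>i \<otimes> e\<^sub>i\<close> in the numbering
  of \<open>kron\<close>.\<close>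

definition diag_vec :: "nat \<Rightarrow> (nat \<Rightarrow> real) \<Rightarrow> complex Matrix.vec" where
  "diag_vec r lam = vec (r * r) (\<lambda>x. if x div r = x mod r then of_real (lam (x div r)) else 0)"

lemma diag_vec_index:
  assumes "i < r" "k < r"
  shows "vec_index (diag_vec r lam) (i * r + k) = (if k = i then of_real (lam i) else 0)"
proof -
  have "i * r + k < (i + 1) * r" using assms by simp
  also have "\<dots> \<le> r * r" using assms by (intro mult_le_mono1) simp
  finally show ?thesis using assms by (auto simp: diag_vec_def)
qed

text \<open>Only the terms with \<open>k = i\<close> and \<open>l = j\<close> survive. With
  \<open>D = diag(lam)\<close> the result is the trace of \<open>D X D Y\<^sup>T\<close>.\<close>

lemma kron_diag_vec:
  assumes X: "X \<in> carrier_mat r r" and Y: "Y \<in> carrier_mat r r"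
  shows "(kron X Y *\<^sub>v diag_vec r lam) \<bullet>c diag_vec r lam =
    (\<Sum>i<r. \<Sum>j<r. of_real (lam i * lam j) * (X $$ (i,j) * Y $$ (i,j)))"
proof -
  have "(kron X Y *\<^sub>v diag_vec r lam) \<bullet>c diag_vec r lam =
    (\<Sum>i<r. \<Sum>k<r. \<Sum>j<r. \<Sum>l<r. cnj (if k = i then of_real (lam i) else 0) *
      (X $$ (i,j) * Y $$ (k,l)) * (if l = j then of_real (lam j) else 0))"
    by (subst kron_qform[OF X Y]) (simp_all add: diag_vec_def[of r lam] diag_vec_index[unfolded diag_vec_def])
  also have "\<dots> = (\<Sum>i<r. \<Sum>k<r. if k = i then
      \<Sum>j<r. of_real (lam i * lam j) * (X $$ (i,j) * Y $$ (i,j)) else 0)"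
  proof (intro sum.cong refl)
    fix i k assume "i \<in> {..<r}" "k \<in> {..<r}"
    have "(\<Sum>l<r. cnj (if k = i then of_real (lam i) else 0) *
        (X $$ (i,j) * Y $$ (k,l)) * (if l = j then of_real (lam j) else 0)) =
      (\<Sum>l<r. if l = j then cnj (if k = i then of_real (lam i) else 0) *
        (X $$ (i,j) * Y $$ (k,l)) * of_real (lam j) else 0)" for j
      by (intro sum.cong) auto
    then show "(\<Sum>j<r. \<Sum>l<r. cnj (if k = i then of_real (lam i) else 0) *
        (X $$ (i,j) * Y $$ (k,l)) * (if l = j then of_real (lam j) else 0)) =
      (if k = i then \<Sum>j<r. of_real (lam i * lam j) * (X $$ (i,j) * Y $$ (i,j)) else 0)"
      by (auto simp: mult_ac intro!: sum.cong)
  qed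
  finally show ?thesis by simp
qed

lemma diag_vec_norm: "diag_vec r lam \<bullet>c diag_vec r lam = of_real (\<Sum>i<r. (lam i)\<^sup>2)"
proof -
  have "diag_vec r lam \<bullet>c diag_vec r lam =
      (\<Sum>p<r * r. vec_index (diag_vec r lam) p * cnj (vec_index (diag_vec r lam) p))"
    by (simp add: scalar_prod_def atLeast0LessThan diag_vec_def)
  also have "\<dots> = (\<Sum>i<r. \<Sum>k<r. if k = i then of_real ((lam i)\<^sup>2) else 0)"
    unfolding sum_lessThan_mult
    by (intro sum.cong refl) (simp add: diag_vec_index power2_eq_square)
  finally show ?thesis by simp
qed

text \<open>Compressing \<open>K\<close> to its support turns it into the diagonal matrix of its eigenvalues
  \<open>lam\<close>, so rescaling by \<open>lam\<^sup>-\<^sup>1\<^sup>/\<^sup>2\<close> on both sides makes every block a POVM.\<close>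

lemma psd_factorization_imp_corr_Q:
  fixes A :: "('a::finite, 'b::finite, 's::finite, 't::finite) idx \<Rightarrow> nat \<Rightarrow> nat \<Rightarrow> complex"
  assumes p: "p \<in> corr_P" and A: "\<And>u. psd_fun d (A u)"
    and K: "\<And>i k l. k < d \<Longrightarrow> l < d \<Longrightarrow> (\<Sum>u\<in>block i. A u k l) = K k l"
    and pA: "\<And>a b s t. complex_of_real (p a b s t) = hs d (A (Inl (s,a))) (A (Inr (t,b)))"
  shows "p \<in> corr_Q"
proof -
  have "psd_fun d (\<lambda>k l. \<Sum>u\<in>block (Inl undefined). A u k l)"
    by (rule psd_fun_sum) (rule A)
  then have "psd_fun d K" by (simp only: K cong: psd_fun_cong)
  then obtain r U lam where E: "eigensystem d K r U lam"
    and KU: "\<And>i j. i < d \<Longrightarrow> j < d \<Longrightarrow> K i j = (\<Sum>k<r. of_real (lam k) * U i k * cnj (U j k))"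
    by (rule psd_fun_spectral) blast
  have lam: "0 < lam k" if "k < r" for k using E that by (simp add: eigensystem_def)
  have nullK: "qform d K (\<lambda>i. compl_proj r U i j) = 0" if "j < d" for j
    by (rule eigensystem_null[OF E KU that])
  \<comment> \<open>\<open>map_sum fst fst\<close> forgets the answer, leaving the question whose
    block contains \<open>u\<close>.\<close>
  have block: "u \<in> block (map_sum fst fst u)" for u :: "('a, 'b, 's, 't) idx"
    by (cases u) auto
  have nullA: "qform d (A u) (\<lambda>i. compl_proj r U i j) = 0" if "j < d" for u j
  proof (rule psd_fun_null_summand)
    show "finite (block (map_sum fst fst u))" by (cases u) auto
    show "(\<Sum>u\<in>block (map_sum fst fst u). A u k l) = K k l" if "k < d" "l < d" for k l
      by (rule K[OF that])
  qed (use A block nullK[OF that] in auto)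
  define e where "e i = 1 / sqrt (lam i)" for i
  define C where "C = (\<lambda>k i. U k i * of_real (e i))"
  have ee: "e i * e i * lam i = 1" if "i < r" for i using lam[OF that] by (simp add: e_def)
  have one: "congr d C K i j = of_bool (i = j)" if "i < r" "j < r" for i j
  proof -
    have "complex_of_real (e i * e i) * of_real (lam i) = 1"
      by (simp only: of_real_mult[symmetric] ee[OF that(1)] of_real_1)
    then show ?thesis
      unfolding C_def congr_scale congr_eigensystem[OF E that] by (auto simp: mult.assoc)
  qed
  define X where "X s a = mat r r (\<lambda>(i,j). congr d C (A (Inl (s,a))) i j)" for s a
  \<comment> \<open>The transpose makes up for the entrywise pairing in
    \<open>kron_diag_vec\<close>: entries \<open>(i,j)\<close> and \<open>(j,i)\<close> are
    multiplied, as in a trace.\<close>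
  define Y where "Y t b = mat r r (\<lambda>(i,j). congr d C (A (Inr (t,b))) j i)" for t b
  have psd: "psd_mat r (mat r r (\<lambda>(i,j). M i j))" if "psd_fun r M" for M :: "nat \<Rightarrow> nat \<Rightarrow> complex"
  proof -
    have "psd_fun r (\<lambda>i j. mat r r (\<lambda>(i,j). M i j) $$ (i,j)) \<longleftrightarrow> psd_fun r M"
      by (rule psd_fun_cong) simp
    with that show ?thesis by (simp add: psd_mat_iff_psd_fun)
  qed
  have X: "povm r (X s)" for s
    unfolding povm_def
  proof (intro conjI allI)
    show "psd_mat r (X s a)" for a
      unfolding X_def by (intro psd psd_fun_congr A)
    have "(\<Sum>a\<in>UNIV. congr d C (A (Inl (s,a))) i j) = congr d C K i j" for i j
      using K[of _ _ "Inl s", unfolded sum_block] by (simp add: congr_sum cong: congr_cong)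
    then show "mat r r (\<lambda>(i,j). \<Sum>a\<in>UNIV. X s a $$ (i,j)) = 1\<^sub>m r"
      by (intro eq_matI) (simp_all add: X_def one)
  qed
  have Y: "povm r (Y t)" for t
    unfolding povm_def
  proof (intro conjI allI)
    show "psd_mat r (Y t b)" for b
      unfolding Y_def by (rule psd, rule psd_fun_transpose, rule psd_fun_congr, rule A)
    have "(\<Sum>b\<in>UNIV. congr d C (A (Inr (t,b))) i j) = congr d C K i j" for i j
      using K[of _ _ "Inr t", unfolded sum_block] by (simp add: congr_sum cong: congr_cong)
    then show "mat r r (\<lambda>(i,j). \<Sum>b\<in>UNIV. Y t b $$ (i,j)) = 1\<^sub>m r"
      by (intro eq_matI) (auto simp: Y_def one)
  qed
  have val: "complex_of_real (p a b s t) =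
      (kron (X s a) (Y t b) *\<^sub>v diag_vec r lam) \<bullet>c diag_vec r lam" for a b s t
  proof -
    let ?A = "congr d U (A (Inl (s,a)))" and ?B = "congr d U (A (Inr (t,b)))"
    have "(kron (X s a) (Y t b) *\<^sub>v diag_vec r lam) \<bullet>c diag_vec r lam =
        (\<Sum>i<r. \<Sum>j<r. of_real (lam i * lam j) * (X s a $$ (i,j) * Y t b $$ (i,j)))"
      by (rule kron_diag_vec) (simp_all add: X_def Y_def)
    also have "\<dots> = (\<Sum>i<r. \<Sum>j<r. ?A i j * ?B j i)"
    proof (intro sum.cong refl)
      fix i j assume "i \<in> {..<r}" "j \<in> {..<r}"
      then have ij: "i < r" "j < r" by auto
      have "lam i * lam j * (e i * e j * (e j * e i)) = (e i * e i * lam i) * (e j * e j * lam j)"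
        by (simp add: mult_ac)
      then have "lam i * lam j * (e i * e j * (e j * e i)) = 1"
        by (simp only: ee[OF ij(1)] ee[OF ij(2)])
      then have "complex_of_real (lam i * lam j) * (of_real (e i * e j) * of_real (e j * e i)) = 1"
        by (simp only: of_real_mult[symmetric] of_real_1)
      then have "complex_of_real (lam i * lam j) * (of_real (e i * e j) * of_real (e j * e i)) *
          (?A i j * ?B j i) = ?A i j * ?B j i" by (simp only: mult_1)
      moreover have "X s a $$ (i,j) = of_real (e i * e j) * ?A i j"
        and "Y t b $$ (i,j) = of_real (e j * e i) * ?B j i"
        using ij by (simp_all add: X_def Y_def C_def congr_scale)
      ultimately show "of_real (lam i * lam j) * (X s a $$ (i,j) * Y t b $$ (i,j)) = ?A i j * ?B j i"
        by (simp only: mult_ac)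
    qed
    also have "\<dots> = hs r ?A ?B"
      using psd_fun_sym[OF psd_fun_congr[OF A]] by (simp add: hs_def)
    also have "\<dots> = hs d (A (Inl (s,a))) (A (Inr (t,b)))"
      by (rule hs_congr[OF A nullA])
    finally show ?thesis using pA by simp
  qed
  \<comment> \<open>The state has norm 1: the probabilities for one pair of questions add up to the
    product of \<open>K\<close> with itself, which is the sum of the squared eigenvalues.\<close>
  have "complex_of_real 1 = (\<Sum>a\<in>UNIV. \<Sum>b\<in>UNIV. of_real (p a b undefined undefined))"
    using p by (simp add: corr_P_def flip: of_real_sum)
  also have "\<dots> = hs d K K"
    unfolding pA sum_hs using K[of _ _ "Inl undefined"] K[of _ _ "Inr undefined"]
    by (intro hs_cong) (simp_all only: sum_block)
  also have "\<dots> = hs r (congr d U K) (congr d U K)"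
    by (rule hs_congr[symmetric, OF \<open>psd_fun d K\<close> nullK])
  also have "\<dots> = (\<Sum>i<r. \<Sum>j<r. if j = i then of_real ((lam i)\<^sup>2) else 0)"
    unfolding hs_def
    by (intro sum.cong refl) (auto simp: congr_eigensystem[OF E] power2_eq_square)
  also have "\<dots> = diag_vec r lam \<bullet>c diag_vec r lam"
    by (simp add: diag_vec_norm)
  finally have norm: "diag_vec r lam \<bullet>c diag_vec r lam = 1" by simp
  have "diag_vec r lam \<in> carrier_vec (r * r)" by (simp add: diag_vec_def)
  with p X Y val norm show ?thesis
    unfolding corr_Q_def by blast
qed

text \<open>At \<open>x + i y\<close> the real part of the form is the form at \<open>x\<close> plus
  the form at \<open>y\<close>, and the imaginary part cancels by symmetry.\<close>

lemma psd_fun_of_real: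
  fixes A :: "nat \<Rightarrow> nat \<Rightarrow> real"
  assumes A: "psd_fun d A"
  shows "psd_fun d (\<lambda>i j. complex_of_real (A i j))"
  unfolding psd_fun_def
proof (intro conjI allI impI)
  have sym: "A i j = A j i" if "i < d" "j < d" for i j
    using psd_fun_sym[OF A that] by simp
  show "complex_of_real (A i j) = conjugate (complex_of_real (A j i))" if "i < d" "j < d" for i j
    using sym[OF that] by simp
  fix v :: "nat \<Rightarrow> complex"
  have "Re (qform d (\<lambda>i j. complex_of_real (A i j)) v) = qform d A (\<lambda>i. Re (v i)) + qform d A (\<lambda>i. Im (v i))"
    by (simp add: qform_def sum.distrib sum_subtractf sum_negf algebra_simps)
  moreover have "Im (qform d (\<lambda>i j. complex_of_real (A i j)) v) =
      (\<Sum>i<d. \<Sum>j<d. Re (v i) * A i j * Im (v j)) - (\<Sum>i<d. \<Sum>j<d. Im (v i) * A i j * Re (v j))"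
    by (simp add: qform_def sum.distrib sum_subtractf sum_negf algebra_simps)
  moreover have "(\<Sum>i<d. \<Sum>j<d. Im (v i) * A i j * Re (v j)) = (\<Sum>j<d. \<Sum>i<d. Im (v i) * A i j * Re (v j))"
    by (rule sum.swap)
  moreover have "\<dots> = (\<Sum>i<d. \<Sum>j<d. Re (v i) * A i j * Im (v j))"
    using sym by (intro sum.cong refl) (simp add: mult_ac)
  ultimately show "0 \<le> qform d (\<lambda>i j. complex_of_real (A i j)) v"
    using psd_fun_qform_nonneg[OF A] by (simp add: less_eq_complex_def)
qed

text \<open>For symmetric matrices the trace of \<open>M u * M v\<close> is the entrywise inner
  product. This makes \<open>X\<close> a Gram matrix, to which the results on common block sums
  apply.\<close>

lemma cone_CSplus_gram:
  fixes X :: "('a::finite, 'b::finite, 's::finite, 't::finite) sqmat"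
  assumes "\<And>u. psd_mat d (M u)" and "X = (\<chi> u v. \<Sum>k<d. (M u * M v) $$ (k,k))"
  shows "X = (\<chi> u v. \<Sum>x\<in>{..<d} \<times> {..<d}. M u $$ x * (M v $$ x :: real))"
proof -
  have M: "M u \<in> carrier_mat d d" for u
    using assms(1)[of u] by (simp add: psd_mat_iff_psd_fun)
  have sym: "M u $$ (i,j) = M u $$ (j,i)" if "i < d" "j < d" for u i j
  proof -
    have "psd_fun d (\<lambda>i j. M u $$ (i,j))" using assms(1)[of u] by (simp add: psd_mat_iff_psd_fun)
    from psd_fun_sym[OF this that] show ?thesis by (simp only: conjugate_real_def)
  qed
  have "(\<Sum>k<d. (M u * M v) $$ (k,k)) = (\<Sum>x\<in>{..<d} \<times> {..<d}. M u $$ x * M v $$ x)" for u v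
  proof -
    have "(\<Sum>k<d. (M u * M v) $$ (k,k)) = (\<Sum>k<d. \<Sum>l<d. M u $$ (k,l) * M v $$ (l,k))"
      using M[of u] M[of v] by (intro sum.cong refl) (auto simp: scalar_prod_def atLeast0LessThan)
    also have "\<dots> = (\<Sum>k<d. \<Sum>l<d. M u $$ (k,l) * M v $$ (k,l))"
      by (intro sum.cong refl arg_cong2[where f = "(*)"] sym) auto
    finally show ?thesis by (simp add: sum.cartesian_product split_def)
  qed
  then show ?thesis by (simp add: assms(2))
qed

lemma cone_CSplus_imp_corr_Q:
  fixes X :: "('a::finite, 'b::finite, 's::finite, 't::finite) sqmat"
  assumes "X \<in> cone_CSplus" and feas: "\<And>i j. block_sum i j X = 1"
  shows "(\<lambda>a b s t. X $ Inl (s,a) $ Inr (t,b)) \<in> corr_Q"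
proof -
  obtain d and M :: "('a, 'b, 's, 't) idx \<Rightarrow> real mat" where
    "\<forall>u. psd_mat d (M u)" and X: "X = (\<chi> u v. \<Sum>k<d. (M u * M v) $$ (k,k))"
    using assms(1) unfolding cone_CSplus_def by blast
  then have M: "\<And>u. psd_mat d (M u)" by blast
  note Xg = cone_CSplus_gram[OF M X]
  obtain \<xi> where \<xi>: "\<And>i x. x \<in> {..<d} \<times> {..<d} \<Longrightarrow> (\<Sum>u\<in>block i. M u $$ x) = \<xi> x"
    using gram_feasible_imp_common_block_sum[OF Xg _ feas] by blast
  define A where "A u i j = complex_of_real (M u $$ (i,j))" for u i j
  have A: "psd_fun d (A u)" for u
    using M[of u] psd_fun_of_real by (simp add: psd_mat_iff_psd_fun A_def[abs_def])
  have XA: "complex_of_real (X $ u $ v) = hs d (A u) (A v)" for u v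
    by (simp add: Xg hs_def A_def sum.cartesian_product split_def)
  show ?thesis
  proof (rule psd_factorization_imp_corr_Q[OF _ A])
    show "(\<lambda>a b s t. X $ Inl (s,a) $ Inr (t,b)) \<in> corr_P"
    proof (rule feasible_in_corr_P[OF _ feas])
      show "0 \<le> X $ u $ v" for u v
        using hs_nonneg[OF A A, of u v] by (simp add: XA[symmetric] less_eq_complex_def)
    qed
    show "(\<Sum>u\<in>block i. A u k l) = complex_of_real (\<xi> (k,l))" if "k < d" "l < d" for i k l
      using \<xi>[of "(k,l)" i] that by (simp add: A_def flip: of_real_sum)
  qed (simp add: XA)
qed

section \<open>From quantum strategies to real psd factorizations\<close>

definition realify :: "nat \<Rightarrow> (nat \<Rightarrow> nat \<Rightarrow> complex) \<Rightarrow> nat \<Rightarrow> nat \<Rightarrow> real" where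
  "realify r H i j =
     (if i < r then (if j < r then Re (H i j) else - Im (H i (j - r)))
      else (if j < r then Im (H (i - r) j) else Re (H (i - r) (j - r)))) / sqrt 2"

lemma sum_lessThan_double:
  fixes f :: "nat \<Rightarrow> 'a::comm_monoid_add"
  shows "(\<Sum>i<r + r. f i) = (\<Sum>i<r. f i) + (\<Sum>i<r. f (r + i))"
proof -
  have "(\<Sum>i<r + n. f i) = (\<Sum>i<r. f i) + (\<Sum>i<n. f (r + i))" for n
    by (induction n) (simp_all add: add.assoc)
  then show ?thesis .
qed

lemma realify_blocks:
  assumes "i < r" "j < r"
  shows "realify r H i j = Re (H i j) / sqrt 2" "realify r H i (r + j) = - Im (H i j) / sqrt 2"
    "realify r H (r + i) j = Im (H i j) / sqrt 2" "realify r H (r + i) (r + j) = Re (H i j) / sqrt 2"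
  using assms by (simp_all add: realify_def)

text \<open>Up to the factor \<open>1 / sqrt 2\<close>, the form at a pair \<open>(x, y)\<close> is
  the real part of the form of \<open>H\<close> at \<open>x + i y\<close>.\<close>

lemma psd_fun_realify:
  assumes H: "psd_fun r H"
  shows "psd_fun (r + r) (realify r H)"
  unfolding psd_fun_def
proof (intro conjI allI impI)
  have sym: "Re (H i j) = Re (H j i)" "Im (H i j) = - Im (H j i)" if "i < r" "j < r" for i j
    using psd_fun_sym[OF H that] by (auto simp: complex_eq_iff)
  show "realify r H i j = conjugate (realify r H j i)" if "i < r + r" "j < r + r" for i j
    using sym[of i j] sym[of "i - r" j] sym[of i "j - r"] sym[of "i - r" "j - r"] that
    by (auto simp: realify_def)
  fix w :: "nat \<Rightarrow> real"
  have "qform (r + r) (realify r H) w = Re (qform r H (\<lambda>i. Complex (w i) (w (r + i)))) / sqrt 2"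
    unfolding qform_def sum_lessThan_double
    by (simp add: realify_blocks)
      (simp add: sum.distrib sum_subtractf sum_negf sum_divide_distrib add_divide_distrib
        diff_divide_distrib algebra_simps)
  then show "0 \<le> qform (r + r) (realify r H) w"
    using psd_fun_qform_nonneg[OF H] by (simp add: less_eq_complex_def)
qed

text \<open>Every real and every imaginary part occurs twice in the doubled matrix; the two factors
  \<open>1 / sqrt 2\<close> compensate for this.\<close>

lemma sum_realify:
  "(\<Sum>i<r + r. \<Sum>j<r + r. realify r H i j * realify r H' i j) = Re (hs r H H')"
proof -
  have "(\<Sum>i<r + r. \<Sum>j<r + r. realify r H i j * realify r H' i j) =
      (\<Sum>i<r. \<Sum>j<r. Re (H i j) * Re (H' i j) + Im (H i j) * Im (H' i j))"
    unfolding sum_lessThan_double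
    by (simp add: realify_blocks sum.distrib) (simp add: sum_divide_distrib[symmetric])
  then show ?thesis by (simp add: hs_def)
qed

lemma realify_sum: "(\<Sum>a\<in>S. realify r (H a) i j) = realify r (\<lambda>i j. \<Sum>a\<in>S. H a i j) i j"
  by (simp add: realify_def sum_divide_distrib[symmetric] sum_negf)

lemma realify_cong:
  assumes "\<And>i j. i < r \<Longrightarrow> j < r \<Longrightarrow> H i j = H' i j" and "i < r + r" "j < r + r"
  shows "realify r H i j = realify r H' i j"
  using assms by (auto simp: realify_def)

text \<open>\<open>realify\<close> is additive, so the blocks keep a common sum, and it preserves
  the real part of the Hilbert-Schmidt product, which is all that matters for a real
  \<open>p\<close>.\<close>

lemma psd_factorization_imp_cone_CSplus:
  fixes F :: "('a::finite, 'b::finite, 's::finite, 't::finite) idx \<Rightarrow> nat \<Rightarrow> nat \<Rightarrow> complex"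
  assumes p: "p \<in> corr_P" and F: "\<And>u. psd_fun r (F u)"
    and D: "\<And>i k l. k < r \<Longrightarrow> l < r \<Longrightarrow> (\<Sum>u\<in>block i. F u k l) = D k l"
    and pF: "\<And>a b s t. complex_of_real (p a b s t) = hs r (F (Inl (s,a))) (F (Inr (t,b)))"
  shows "\<exists>X\<in>cone_CSplus. (\<forall>i j. block_sum i j X = 1) \<and>
      (\<forall>a b s t. p a b s t = X $ Inl (s,a) $ Inr (t,b))"
proof -
  let ?d = "r + r"
  define M where "M u = mat ?d ?d (\<lambda>(i,j). realify r (F u) i j)" for u
  define X :: "('a, 'b, 's, 't) sqmat" where "X = (\<chi> u v. \<Sum>k<?d. (M u * M v) $$ (k,k))"
  have M: "psd_mat ?d (M u)" for u
    using psd_fun_realify[OF F[of u]] by (simp add: psd_mat_iff_psd_fun M_def cong: psd_fun_cong)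
  note Xg = cone_CSplus_gram[OF M X_def]
  have "X $ u $ v = Re (hs r (F u) (F v))" for u v
    unfolding sum_realify[symmetric] sum.cartesian_product
    by (auto simp: Xg M_def intro!: sum.cong)
  then have pX: "p a b s t = X $ Inl (s,a) $ Inr (t,b)" for a b s t
    by (metis Re_complex_of_real pF)
  define \<xi> where "\<xi> x = realify r D (fst x) (snd x)" for x
  have sums: "(\<Sum>u\<in>block i. M u $$ x) = \<xi> x" if "x \<in> {..<?d} \<times> {..<?d}" for i x
  proof -
    have "(\<Sum>u\<in>block i. M u $$ x) = realify r (\<lambda>k l. \<Sum>u\<in>block i. F u k l) (fst x) (snd x)"
      using that by (auto simp: M_def realify_sum)
    also have "\<dots> = \<xi> x"
      unfolding \<xi>_def using that by (intro realify_cong) (auto simp: D)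
    finally show ?thesis .
  qed
  have P: "(\<lambda>a b s t. X $ Inl (s,a) $ Inr (t,b)) \<in> corr_P"
    using p by (simp add: pX[symmetric])
  have feas: "block_sum i j X = 1" for i j
    by (rule common_block_sum_imp_gram_feasible(1)[OF Xg sums P])
  have "(\<Sum>x\<in>{..<?d} \<times> {..<?d}. (\<xi> x)\<^sup>2) = 1"
    by (rule common_block_sum_imp_gram_feasible(2)[OF Xg sums P])
  \<comment> \<open>A vector of norm 1 needs a nonempty index set; this gives the dimension bound in
    \<open>cone_CSplus\<close>.\<close>
  then have "1 \<le> ?d" by (cases r) auto
  then have "X \<in> cone_CSplus"
    unfolding cone_CSplus_def using M X_def by blast
  with feas pX show ?thesis by blast
qed

lemma povmD:
  assumes "povm d M"
  shows "M a \<in> carrier_mat d d" "psd_fun d (\<lambda>i j. M a $$ (i,j))"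
    "i < d \<Longrightarrow> j < d \<Longrightarrow> (\<Sum>a\<in>UNIV. M a $$ (i,j)) = of_bool (i = j)"
proof -
  show "M a \<in> carrier_mat d d" "psd_fun d (\<lambda>i j. M a $$ (i,j))"
    using assms by (auto simp: povm_def psd_mat_iff_psd_fun)
  assume "i < d" "j < d"
  moreover have "mat d d (\<lambda>(i,j). \<Sum>a\<in>UNIV. M a $$ (i,j)) $$ (i,j) = 1\<^sub>m d $$ (i,j)"
    using assms by (simp add: povm_def)
  ultimately show "(\<Sum>a\<in>UNIV. M a $$ (i,j)) = of_bool (i = j)" by simp
qed

text \<open>Write \<open>\<psi>\<close> as a matrix \<open>P\<close>, so that \<open>p(a,b|s,t)\<close> is the trace of \<open>X P Y\<^sup>T P\<^sup>*\<close>, and diagonalize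
  \<open>P P\<^sup>* = U diag(lam) U\<^sup>*\<close>. With \<open>G = U\<^sup>* P\<close> the operators \<open>lam\<^sup>1\<^sup>/\<^sup>4 U\<^sup>* X U lam\<^sup>1\<^sup>/\<^sup>4\<close> and
  \<open>lam\<^sup>-\<^sup>1\<^sup>/\<^sup>4 G Y\<^sup>T G\<^sup>* lam\<^sup>-\<^sup>1\<^sup>/\<^sup>4\<close> then both add up to \<open>lam\<^sup>1\<^sup>/\<^sup>2\<close>.\<close>

lemma corr_Q_imp_cone_CSplus:
  fixes p :: "('a::finite, 'b::finite, 's::finite, 't::finite) correlation"
  assumes "p \<in> corr_Q"
  shows "\<exists>X\<in>cone_CSplus. (\<forall>i j. block_sum i j X = 1) \<and>
      (\<forall>a b s t. p a b s t = X $ Inl (s,a) $ Inr (t,b))"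
proof -
  obtain m n \<psi> and X :: "'s \<Rightarrow> 'a \<Rightarrow> complex mat" and Y :: "'t \<Rightarrow> 'b \<Rightarrow> complex mat" where
    p: "p \<in> corr_P" and \<psi>: "\<psi> \<in> carrier_vec (m * n)"
    and XY: "\<forall>s. povm m (X s)" "\<forall>t. povm n (Y t)"
    and val: "\<forall>a b s t. complex_of_real (p a b s t) = (kron (X s a) (Y t b) *\<^sub>v \<psi>) \<bullet>c \<psi>"
    using assms unfolding corr_Q_def by blast
  note X = povmD[OF XY(1)[rule_format]] and Y = povmD[OF XY(2)[rule_format]]
  define P where "P i k = vec_index \<psi> (i * n + k)" for i k
  define H where "H i j = (\<Sum>k<n. P i k * cnj (P j k))" for i j
  have "psd_fun m H" unfolding H_def[abs_def] by (rule psd_fun_gram)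
  then obtain r U lam where E: "eigensystem m H r U lam"
    and HU: "\<And>i j. i < m \<Longrightarrow> j < m \<Longrightarrow> H i j = (\<Sum>k<r. of_real (lam k) * U i k * cnj (U j k))"
    by (rule psd_fun_spectral) blast
  have lam: "0 < lam k" if "k < r" for k using E that by (simp add: eigensystem_def)
  define G where "G k l = (\<Sum>i<m. cnj (U i k) * P i l)" for k l
  \<comment> \<open>\<open>H = P P\<^sup>*\<close> vanishes on the range of the complementary
    projection \<open>W\<close>, so \<open>qform_gram\<close> gives \<open>W P = 0\<close>, that is,
    \<open>P = U U\<^sup>* P = U G\<close>.\<close>
  have PG: "P j l = (\<Sum>k<r. U j k * G k l)" if "j < m" "l < n" for j l
  proof -
    have "(\<Sum>k<n. (cmod (\<Sum>i<m. cnj (compl_proj r U i j) * P i k))\<^sup>2) = 0"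
      using eigensystem_null[OF E HU \<open>j < m\<close>] unfolding H_def qform_gram
      by (simp only: of_real_eq_0_iff)
    then have "(\<Sum>i<m. cnj (compl_proj r U i j) * P i l) = 0"
      using \<open>l < n\<close> by (simp add: sum_nonneg_eq_0_iff)
    then have "0 = cnj (\<Sum>i<m. cnj (compl_proj r U i j) * P i l)" by simp
    also have "\<dots> = (\<Sum>i<m. cnj (P i l) * compl_proj r U i j)"
      by (simp add: mult.commute)
    also have "\<dots> = cnj (P j l) - (\<Sum>k<r. (\<Sum>i<m. cnj (P i l) * U i k) * cnj (U j k))"
      by (rule sum_mult_compl_proj[OF \<open>j < m\<close>])
    finally have "cnj (P j l) = (\<Sum>k<r. (\<Sum>i<m. cnj (P i l) * U i k) * cnj (U j k))" by simp
    then have "cnj (cnj (P j l)) = cnj (\<Sum>k<r. (\<Sum>i<m. cnj (P i l) * U i k) * cnj (U j k))"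
      by (rule arg_cong)
    then show ?thesis by (simp add: G_def mult.commute)
  qed
  \<comment> \<open>\<open>G G\<^sup>* = U\<^sup>* H U\<close>, which is the diagonal matrix of the
    eigenvalues.\<close>
  have GG: "(\<Sum>k<n. G i k * cnj (G j k)) = of_real (lam j) * of_bool (i = j)" if "i < r" "j < r" for i j
  proof -
    have "(\<Sum>k<n. G i k * cnj (G j k)) =
        (\<Sum>k<n. \<Sum>p<m. \<Sum>q<m. cnj (U p i) * (P p k * cnj (P q k)) * U q j)"
      by (simp add: G_def sum_product mult_ac)
    also have "\<dots> = congr m U H i j"
      by (subst sum_rotate3) (simp add: congr_def H_def sum_distrib_left sum_distrib_right)
    finally show ?thesis using congr_eigensystem[OF E that] by simp
  qed
  define e where "e i = sqrt (sqrt (lam i))" for i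
  have e: "e i \<noteq> 0" "e i * e i = sqrt (lam i)" "lam i / (e i * e i) = sqrt (lam i)" if "i < r" for i
    using lam[OF that] by (simp_all add: e_def real_div_sqrt)
  define M where "M s a = congr m (\<lambda>k i. U k i * of_real (e i)) (\<lambda>i j. X s a $$ (i,j))" for s a
  \<comment> \<open>The conjugating matrix is \<open>G\<^sup>*\<close>, whose entry at
    \<open>(k, i)\<close> is \<open>cnj (G i k)\<close>, so \<open>congr\<close> yields
    \<open>G Y\<^sup>T G\<^sup>*\<close> up to scaling.\<close>
  define N where "N t b = congr n (\<lambda>k i. cnj (G i k) * of_real (1 / e i)) (\<lambda>i j. Y t b $$ (j,i))" for t b
  define F where "F u = (case u of Inl (s,a) \<Rightarrow> M s a | Inr (t,b) \<Rightarrow> N t b)" for u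
  show ?thesis
  proof (rule psd_factorization_imp_cone_CSplus[OF p])
    show "psd_fun r (F u)" for u
      by (auto simp: F_def M_def N_def X(2) psd_fun_transpose[OF Y(2)] intro!: psd_fun_congr
          split: sum.split)
    show "(\<Sum>u\<in>block i. F u k l) = of_real (sqrt (lam l)) * of_bool (k = l)" if kl: "k < r" "l < r" for i k l
    proof (cases i)
      case (Inl s)
      have "(\<Sum>u\<in>block i. F u k l) = (\<Sum>a\<in>UNIV. M s a k l)"
        unfolding Inl sum_block by (simp add: F_def)
      also have "\<dots> = congr m (\<lambda>k i. U k i * of_real (e i)) (\<lambda>i j. \<Sum>a\<in>UNIV. X s a $$ (i,j)) k l"
        by (simp only: M_def congr_sum)
      also have "\<dots> = congr m (\<lambda>k i. U k i * of_real (e i)) (\<lambda>i j. of_bool (i = j)) k l"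
        by (rule congr_cong) (rule X(3))
      also have "\<dots> = of_real (e k * e l) * congr m U (\<lambda>i j. of_bool (i = j)) k l"
        by (rule congr_scale)
      also have "\<dots> = of_real (e k * e l) * of_bool (k = l)"
        using E kl by (simp add: congr_id eigensystem_def orthonormal_def)
      finally show ?thesis using e(2)[OF kl(1)] by (auto simp flip: of_real_mult)
    next
      case (Inr t)
      have "(\<Sum>u\<in>block i. F u k l) = (\<Sum>b\<in>UNIV. N t b k l)"
        unfolding Inr sum_block by (simp add: F_def)
      also have "\<dots> = congr n (\<lambda>k i. cnj (G i k) * of_real (1 / e i))
          (\<lambda>i j. \<Sum>b\<in>UNIV. Y t b $$ (j,i)) k l"
        by (simp only: N_def congr_sum)
      also have "\<dots> = congr n (\<lambda>k i. cnj (G i k) * of_real (1 / e i)) (\<lambda>i j. of_bool (i = j)) k l"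
        by (rule congr_cong) (auto simp: Y(3))
      also have "\<dots> = of_real (1 / e k * (1 / e l)) * congr n (\<lambda>k i. cnj (G i k)) (\<lambda>i j. of_bool (i = j)) k l"
        by (rule congr_scale)
      also have "congr n (\<lambda>k i. cnj (G i k)) (\<lambda>i j. of_bool (i = j)) k l = of_real (lam l) * of_bool (k = l)"
        unfolding GG[OF kl, symmetric] congr_id by simp
      finally show ?thesis using e(3)[OF kl(1)] by (auto simp flip: of_real_mult of_real_divide)
    qed
    show "complex_of_real (p a b s t) = hs r (F (Inl (s,a))) (F (Inr (t,b)))" for a b s t
    proof -
      let ?X = "\<lambda>i j. X s a $$ (i,j)" and ?Y = "\<lambda>i j. Y t b $$ (i,j)"
      \<comment> \<open>The scalings \<open>e i * e j\<close> and \<open>1 / (e i * e j)\<close> of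
        the two factors cancel.\<close>
      have "hs r (F (Inl (s,a))) (F (Inr (t,b))) =
          (\<Sum>i<r. \<Sum>j<r. congr m U ?X i j * cnj (congr n (\<lambda>k i. cnj (G i k)) (\<lambda>i j. ?Y j i) i j))"
        unfolding hs_def F_def M_def N_def sum.case prod.case congr_scale
        using e(1) by (intro sum.cong refl) simp
      also have "\<dots> = (\<Sum>i<r. \<Sum>j<r. \<Sum>k<m. \<Sum>l<m. \<Sum>x<n. \<Sum>y<n.
          ?X k l * ?Y x y * (cnj (U k i) * cnj (G i x) * (U l j * G j y)))"
      proof (intro sum.cong refl)
        fix i j
        let ?N = "congr n (\<lambda>k i. cnj (G i k)) (\<lambda>i j. ?Y j i) i j"
        have "cnj ?N = (\<Sum>x<n. \<Sum>y<n. cnj (G i x) * ?Y x y * G j y)"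
          using psd_fun_sym[OF Y(2)] by (simp add: congr_def)
        moreover have "congr m U ?X i j * cnj ?N = (\<Sum>k<m. \<Sum>l<m. cnj (U k i) * ?X k l * U l j * cnj ?N)"
          by (simp only: congr_def[of m] sum_distrib_right)
        ultimately show "congr m U ?X i j * cnj ?N =
            (\<Sum>k<m. \<Sum>l<m. \<Sum>x<n. \<Sum>y<n. ?X k l * ?Y x y * (cnj (U k i) * cnj (G i x) * (U l j * G j y)))"
          by (simp add: sum_distrib_left mult_ac)
      qed
      also have "\<dots> = (\<Sum>k<m. \<Sum>l<m. \<Sum>x<n. \<Sum>y<n. \<Sum>i<r. \<Sum>j<r.
          ?X k l * ?Y x y * (cnj (U k i) * cnj (G i x) * (U l j * G j y)))"
        by (rule trans[OF sum_swap_pairs]) (intro sum.cong[OF refl] sum_swap_pairs)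
      \<comment> \<open>The inner sums over \<open>i\<close> and \<open>j\<close> reassemble the
        entries of \<open>P = U G\<close>.\<close>
      also have "\<dots> = (\<Sum>k<m. \<Sum>l<m. \<Sum>x<n. \<Sum>y<n. ?X k l * ?Y x y * (cnj (P k x) * P l y))"
      proof (intro sum.cong refl)
        fix k l x y assume "k \<in> {..<m}" "l \<in> {..<m}" "x \<in> {..<n}" "y \<in> {..<n}"
        then have "cnj (P k x) * P l y = (\<Sum>i<r. \<Sum>j<r. cnj (U k i) * cnj (G i x) * (U l j * G j y))"
          by (simp add: PG sum_product)
        then show "(\<Sum>i<r. \<Sum>j<r. ?X k l * ?Y x y * (cnj (U k i) * cnj (G i x) * (U l j * G j y))) =
            ?X k l * ?Y x y * (cnj (P k x) * P l y)"
          by (simp add: sum_distrib_left)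
      qed
      also have "\<dots> = (\<Sum>k<m. \<Sum>x<n. \<Sum>l<m. \<Sum>y<n. cnj (P k x) * (?X k l * ?Y x y) * P l y)"
        by (rule sum.cong[OF refl], subst sum.swap) (simp add: mult_ac)
      also have "\<dots> = (kron (X s a) (Y t b) *\<^sub>v \<psi>) \<bullet>c \<psi>"
        by (simp add: kron_qform[OF X(1) Y(1) \<psi>] P_def)
      finally show ?thesis using val by simp
    qed
  qed
qed

lemma quantum_value: "game_value corr_Q \<pi> V = conic_value cone_CSplus \<pi> V"
proof (rule game_value_eq_conic_value)
  fix X :: "('a, 'b, 'c, 'd) sqmat" assume "X \<in> cone_CSplus"
  then obtain d and M :: "('a, 'b, 'c, 'd) idx \<Rightarrow> real mat" where
    "\<forall>u. psd_mat d (M u)" and X: "X = (\<chi> u v. \<Sum>k<d. (M u * M v) $$ (k,k))"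
    unfolding cone_CSplus_def by blast
  then have "X = (\<chi> u v. \<Sum>x\<in>{..<d} \<times> {..<d}. M u $$ x * M v $$ x)"
    by (intro cone_CSplus_gram) auto
  then show "transpose X = X"
    by (simp add: transpose_def vec_eq_iff mult.commute)
qed (simp_all add: corr_Q_imp_cone_CSplus cone_CSplus_imp_corr_Q)

theorem theorem4p1:
  fixes \<pi> :: "('s::finite \<times> 't::finite) pmf"
    and V :: "('a::finite, 'b::finite, 's, 't) predicate"
  shows "game_value corr_C \<pi> V = conic_value cone_CP \<pi> V
    \<and> game_value corr_Q \<pi> V = conic_value cone_CSplus \<pi> V
    \<and> game_value corr_NS \<pi> V = conic_value cone_NSO \<pi> V
    \<and> game_value corr_P \<pi> V = conic_value cone_N \<pi> V"
  using classical_value quantum_value no_signaling_value unrestricted_value by blast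

end
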